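(* Consider the two-stage mixed-integer problem $\inf_{x\in\mathcal X}f_0(x)+\mathbb E[f(\xi,x)]$ with $$f(\xi,x)=\inf_{y,y_0}\{g(\xi,y,y_0): W_\xi y+W^0_\xi y_0+T_\xi x=h_\xi,\ y\in\mathbb R_+^{n'},\ y_0\in\mathcal Z\},\qquad \mathcal Z\subseteq\mathbb Z_+^{p'}.$$ Suppose $|\mathcal Z|<+\infty$ and $|J|<+\infty$, where $$|J|=\max_{\xi\in\Xi}\{\text{number of extreme rays of the cone }\{a:a^TW_\xi\ge0\}\}.$$ Let $\xi^{[N]}=(\xi_1,\dots,\xi_N)$ be IID samples from $\mathbb P$ (so $\xi^{[N]}\sim\mathbb P^N$), and let $x^\star(\xi^{[N]})$ be the output of any algorithm that is guaranteed to be within the feasible region of SAA. Set $$d_{VC}=\Big(\frac{e}{(e-1)\log2}\Big)^2|\mathcal Z|\,|J|\,(n+2)\log\Big(\frac{e|J|}{\log 2}\Big)\log\Big(\frac{e|\mathcal Z|}{\log 2}\Big).$$ Then, for any $0<\delta,\epsilon<1$, if $$N\ge\frac4\epsilon\Big(d_{VC}\log\big(\tfrac{12}{\epsilon}\big)+\log\big(\tfrac2\delta\big)\Big),$$ we have $\mathbb P^N\big(V(x^\star(\xi^{[N]}))>\epsilon\big)\le\delta$. Equivalently, in terms of convergence rate, $$\mathbb P^N\big(V(x^\star(\xi^{[N]}))>\epsilon\big)\le 2\exp\Big(-\frac{N\epsilon}{4}\Big)\Big(\frac{12}{\epsilon}\Big)^{d_{VC}}.$$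
   Context: Setting. $(\Omega,\mathcal F,\mathbb P)$ is a complete probability space and $\xi:\Omega\to\Xi\subseteq\mathbb R^r$ a random vector ($\mathbb P$ also denotes its law). $\mathcal X\subseteq\mathbb R^{n-p}\times\mathbb Z^p$ (a subset of $\mathbb R^n$) is nonempty and closed. $n',p'$ are given nonnegative integers. $f_0$ is a deterministic real-valued function of $x$. $W_\xi,W^0_\xi,T_\xi$ are matrices and $h_\xi$ a vector, of compatible sizes, depending on $\xi$. The function $g(\xi,\cdot,\cdot)$ is finite everywhere, for almost every $\xi\in\Xi$. The infimum over an empty set is $+\infty$. It is assumed that $f$ takes values in $\mathbb R\cup\{+\infty\}$, that $f(\xi,\cdot)$ is lower semicontinuous on $\mathcal X$, that $(\omega,x)\mapsto f(\xi(\omega),x)$ is measurable for the completion of $\mathcal F\otimes\mathscr B$ ($\mathscr B$ the Borel $\sigma$-algebra of $\mathcal X$), that the set of $x\in\mathcal X$ with finite objective $F(x)=f_0(x)+\mathbb E[f(\xi,x)]<+\infty$ is non-empty, and that all quantities of interest are measurable. The rows of each matrix $W_\xi$ are assumed linearly independent, so that each cone $\{a:a^TW_\xi\ge0\}$ is pointed and is minimally generated by its unique finite set of non-equivalent extreme rays (two rays are equivalent if they are positive multiples of each other); "number of extreme rays" counts non-equivalent ones. $\mathbb P^N$ is the joint law of $N$ IID samples of $\xi$. The SAA problem replaces $\mathbb E[f(\xi,x)]$ by $\frac1N\sum_{i=1}^N f(\xi_i,x)$; its feasible region is $\bigcap_{i=1}^N\{x\in\mathcal X:f(\xi_i,x)<+\infty\}$.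 The violation probability is $V(x)=\mathbb P(\xi\in\Xi:f(\xi,x)=+\infty)$ for $x\in\mathcal X$. $\log$ is the natural logarithm. *)

theory Defs
  imports "HOL-Probability.Probability" "Jordan_Normal_Form.VS_Connect"
begin

text \<open>The first-stage variable lives in \<open>real ^ 'n\<close>. The second-stage vectors and matrices use the
  carrier-based types of \<^theory>\<open>Jordan_Normal_Form.Matrix\<close>, so that \<open>n' = 0\<close>, \<open>p' = 0\<close> and
  matrices whose number of rows depends on the scenario are allowed.\<close>

text \<open>\<open>I\<close> is the set of integer coordinates, so this is the space
  \<open>\<real>\<^sup>n\<^sup>-\<^sup>p \<times> \<int>\<^sup>p\<close> with \<open>p = card I\<close>, up to the order of the coordinates.\<close>

definition mixed_integer_space :: "'n set \<Rightarrow> (real ^ 'n::finite) set" where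
  "mixed_integer_space I = {x. \<forall>i\<in>I. vec_nth x i \<in> \<int>}"

text \<open>The \<open>i\<close>-th entry of \<open>T\<close> is the \<open>i\<close>-th row of the matrix \<open>T\<close>, hence
  \<open>T x = map_vec (\<lambda>t. inner t x) T\<close>. The infimum of the empty set is \<open>\<infinity>\<close> in \<^typ>\<open>ereal\<close>.\<close>

definition second_stage_value ::
  "nat \<Rightarrow> nat Matrix.vec set \<Rightarrow> real mat \<Rightarrow> real mat \<Rightarrow> (real ^ 'n::finite) Matrix.vec
    \<Rightarrow> real Matrix.vec \<Rightarrow> (real Matrix.vec \<Rightarrow> nat Matrix.vec \<Rightarrow> ereal) \<Rightarrow> real ^ 'n \<Rightarrow> ereal" where
  "second_stage_value n' Z W W0 T h g x =
     Inf {g y y0 | y y0.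
            y \<in> carrier_vec n' \<and> 0\<^sub>v n' \<le> y \<and> y0 \<in> Z \<and>
            W *\<^sub>v y + W0 *\<^sub>v map_vec real y0 + map_vec (\<lambda>t. inner t x) T = h}"

definition rows_lin_indpt :: "real mat \<Rightarrow> bool" where
  "rows_lin_indpt W \<longleftrightarrow> distinct (rows W) \<and>
     LinearCombinations.module.lin_indpt class_ring (module_vec TYPE(real) (dim_col W)) (set (rows W))"

text \<open>The cone of all \<open>a\<close> with \<open>a\<^sup>T W \<ge> 0\<close>.\<close>

definition dual_cone :: "real mat \<Rightarrow> real Matrix.vec set" where
  "dual_cone W = {a \<in> carrier_vec (dim_row W). 0\<^sub>v (dim_col W) \<le> transpose_mat W *\<^sub>v a}"

definition spans_extreme_ray :: "real Matrix.vec set \<Rightarrow> real Matrix.vec \<Rightarrow> bool" where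
  "spans_extreme_ray C a \<longleftrightarrow> a \<in> C \<and> a \<noteq> 0\<^sub>v (dim_vec a) \<and>
     (\<forall>b\<in>C. \<forall>c\<in>C. b + c = a \<longrightarrow> (\<exists>s\<ge>0. b = s \<cdot>\<^sub>v a) \<and> (\<exists>t\<ge>0. c = t \<cdot>\<^sub>v a))"

text \<open>Equivalent (positively proportional) rays give the same open half-line, so the cardinality
  of this set is the number of non-equivalent extreme rays.\<close>

definition extreme_rays :: "real Matrix.vec set \<Rightarrow> real Matrix.vec set set" where
  "extreme_rays C = {{t \<cdot>\<^sub>v a | t. t > 0} | a. spans_extreme_ray C a}"

definition lsc_on :: "'a::topological_space set \<Rightarrow> ('a \<Rightarrow> ereal) \<Rightarrow> bool" where
  "lsc_on X \<phi> \<longleftrightarrow> (\<forall>x\<in>X. \<phi> x \<le> Liminf (at x within X) \<phi>)"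

text \<open>Measurability for the completion of the product of the \<open>\<sigma>\<close>-algebra of \<open>M\<close> with the Borel
  \<open>\<sigma>\<close>-algebra of \<open>X\<close>. No reference measure on \<open>X\<close> is given, so completion is required with
  respect to the product of \<open>M\<close> with every Borel probability measure on \<open>X\<close>. This is implied by
  plain product measurability, and by measurability up to sets whose projection is \<open>M\<close>-null.\<close>

definition completion_measurable_on ::
  "'w measure \<Rightarrow> 'a::topological_space set \<Rightarrow> ('w \<times> 'a \<Rightarrow> ereal) \<Rightarrow> bool" where
  "completion_measurable_on M X \<phi> \<longleftrightarrow>
     (\<forall>\<mu>. prob_space \<mu> \<and> sets \<mu> = sets (restrict_space borel X) \<longrightarrow>
          \<phi> \<in> borel_measurable (completion (M \<Otimes>\<^sub>M \<mu>)))"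

text \<open>Expectation of an extended-real random variable as the integral of the positive part minus
  that of the negative part (note that \<open>e2ennreal\<close> truncates negative arguments to \<open>0\<close>), with the
  convention \<open>\<infinity> - \<infinity> = \<infinity>\<close> of \<^typ>\<open>ereal\<close>.\<close>

definition ext_expectation :: "'w measure \<Rightarrow> ('w \<Rightarrow> ereal) \<Rightarrow> ereal" where
  "ext_expectation M \<phi> =
     enn2ereal (\<integral>\<^sup>+\<omega>. e2ennreal (\<phi> \<omega>) \<partial>M) - enn2ereal (\<integral>\<^sup>+\<omega>. e2ennreal (- \<phi> \<omega>) \<partial>M)"

definition violation_prob :: "'w measure \<Rightarrow> ('w \<Rightarrow> 's) \<Rightarrow> ('s \<Rightarrow> 'a \<Rightarrow> ereal) \<Rightarrow> 'a \<Rightarrow> real" where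
  "violation_prob M \<xi> f x = measure M {\<omega> \<in> space M. f (\<xi> \<omega>) x = \<infinity>}"

definition saa_feasible :: "'a set \<Rightarrow> ('s \<Rightarrow> 'a \<Rightarrow> ereal) \<Rightarrow> nat \<Rightarrow> (nat \<Rightarrow> 's) \<Rightarrow> 'a set" where
  "saa_feasible X f N s = {x \<in> X. \<forall>i<N. f (s i) x < \<infinity>}"

text \<open>The \<open>N\<close> IID samples are realised on the (completed) \<open>N\<close>-fold product of \<open>M\<close> as
  \<open>\<xi>\<^sub>i(\<omega>) = \<xi>(\<omega>\<^sub>i)\<close>, where the indices are \<open>0, \<dots>, N - 1\<close>. Probabilities of sample events are
  probabilities on this space, which avoids assuming that events such as
  \<open>{\<zeta>. f \<zeta> x = \<infinity>}\<close> are Borel in the range of \<open>\<xi>\<close>.\<close>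

definition sample_space :: "'w measure \<Rightarrow> nat \<Rightarrow> (nat \<Rightarrow> 'w) measure" where
  "sample_space M N = completion (\<Pi>\<^sub>M i\<in>{..<N}. M)"

definition iid_sample :: "('w \<Rightarrow> 's) \<Rightarrow> nat \<Rightarrow> (nat \<Rightarrow> 'w) \<Rightarrow> nat \<Rightarrow> 's" where
  "iid_sample \<xi> N \<omega> = (\<lambda>i\<in>{..<N}. \<xi> (\<omega> i))"

definition vc_bound :: "nat \<Rightarrow> nat \<Rightarrow> nat \<Rightarrow> real" where
  "vc_bound nZ nJ n =
     (exp 1 / ((exp 1 - 1) * ln 2))\<^sup>2 * real nZ * real nJ * (real n + 2)
       * ln (exp 1 * real nJ / ln 2) * ln (exp 1 * real nZ / ln 2)"

end

theory Submission
  imports Defs "Jordan_Normal_Form.DL_Rank"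
begin

text \<open>By Farkas' lemma and the extreme rays of the dual cone, for each scenario the feasible set is a
  union of at most \<open>|Z|\<close> polyhedra with at most \<open>|J|\<close> facets each. Hence \<open>2 N\<close> scenarios are
  governed by \<open>K = 2 N |Z| |J|\<close> affine inequalities in \<open>x\<close>, and for every \<open>0 < s \<le> 1\<close> these have at
  most \<open>(1 + s)\<^sup>K / s\<^sup>n\<close> sign patterns.

  For the probabilistic step, draw a second independent sample and let \<open>k\<close> be the number of its
  scenarios violated by \<open>x\<^sup>\<star>\<close>, which is computed from the first sample. On the event \<open>V(x\<^sup>\<star>) > \<epsilon>\<close>
  the conditional mean of \<open>2\<^sup>k\<close> is at least \<open>(1 + \<epsilon>)\<^sup>N\<close>; swapping the two samples coordinatewise at
  random shows that, over this event, \<open>2\<^sup>k\<close> integrates to at most the number of violation patterns.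
  Choosing \<open>s = \<epsilon> / (6 |Z| |J|)\<close> gives the rate, with \<open>d\<^sub>V\<^sub>C\<close> entering only through
  \<open>d\<^sub>V\<^sub>C \<ge> |Z| |J| n\<close>. Since the conditional mean is taken at \<open>x\<^sup>\<star>\<close> only, measurability up to
  null sets of the product with the law of \<open>x\<^sup>\<star>\<close> is enough.\<close>

subsection \<open>Sign patterns of affine functions\<close>

text \<open>By induction on the constraints: a new inequality adds one pattern for each old pattern
  compatible with both of its truth values, and these already occur on its hyperplane, in one
  dimension less; hence the general affine set \<open>S\<close>. The bound closes the recursion
  because \<open>(1 + s) ^ m / s ^ k + s * ((1 + s) ^ m / s ^ k) = (1 + s) ^ (m + 1) / s ^
  k\<close>. A free \<open>s\<close> replaces binomial sums and is optimised only at the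
  end.\<close>

lemma card_sign_patterns:
  fixes a :: "'i \<Rightarrow> 'e::euclidean_space" and b :: "'i \<Rightarrow> real"
  assumes "finite I" and s: "0 < s" "s \<le> 1" and "affine S" "aff_dim S \<le> int k"
  shows "real (card ((\<lambda>x. {i\<in>I. b i \<le> inner (a i) x}) ` S)) \<le> (1 + s) ^ card I / s ^ k"
  using assms(1,4,5)
proof (induction I arbitrary: S k)
  case empty
  have "card ((\<lambda>x. {i\<in>{}. b i \<le> inner (a i) x}) ` S) \<le> card {{} :: 'i set}"
    by (rule card_mono) auto
  moreover have "s ^ k \<le> 1" using s by (simp add: power_le_one)
  then have "1 \<le> 1 / s ^ k" using s by (simp add: field_simps)
  ultimately show ?case by simp
next
  case (insert i I)
  define p where "p = (\<lambda>x. {j\<in>I. b j \<le> inner (a j) x})"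
  define S0 where "S0 = S \<inter> {x. inner (a i) x < b i}"
  define S1 where "S1 = S \<inter> {x. b i \<le> inner (a i) x}"
  define H where "H = S \<inter> {x. inner (a i) x = b i}"
  have fin: "finite (p ` A)" for A
    by (rule finite_subset[of _ "Pow I"]) (use insert in \<open>auto simp: p_def\<close>)
  have split: "(\<lambda>x. {j\<in>insert i I. b j \<le> inner (a j) x}) ` S = p ` S0 \<union> (Set.insert i) ` (p ` S1)"
    unfolding p_def S0_def S1_def by (fastforce simp: image_iff)
  have inj: "inj_on (Set.insert i) (p ` S1)"
    using insert.hyps by (auto simp: inj_on_def p_def insert_ident)
  \<comment> \<open>By inclusion-exclusion, the excess over the patterns of \<open>I\<close> is the
    number of patterns attained on both sides of the new constraint.\<close>
  have "card (p ` S0 \<union> (Set.insert i) ` (p ` S1)) \<le> card (p ` S0) + card (p ` S1)"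
    using card_Un_le[of "p ` S0" "Set.insert i ` p ` S1"] card_image[OF inj] by simp
  also have "\<dots> = card (p ` S0 \<union> p ` S1) + card (p ` S0 \<inter> p ` S1)"
    by (rule card_Un_Int) (auto intro: fin)
  also have "p ` S0 \<union> p ` S1 = p ` S"
    unfolding S0_def S1_def by force
  finally have card_le: "card ((\<lambda>x. {j\<in>insert i I. b j \<le> inner (a j) x}) ` S)
      \<le> card (p ` S) + card (p ` S0 \<inter> p ` S1)"
    unfolding split .
  have Sk: "real (card (p ` S)) \<le> (1 + s) ^ card I / s ^ k"
    unfolding p_def by (rule insert.IH[OF insert.prems])
  \<comment> \<open>A pattern that extends both ways is attained on both sides of the hyperplane, hence, by
    convexity, on the hyperplane itself, where the dimension is smaller.\<close>
  have sub: "p ` S0 \<inter> p ` S1 \<subseteq> p ` H"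
  proof
    fix c assume "c \<in> p ` S0 \<inter> p ` S1"
    then obtain x y where xy: "x \<in> S0" "y \<in> S1" "p x = c" "p y = c" by blast
    have c: "j \<in> c \<longleftrightarrow> j \<in> I \<and> b j \<le> inner (a j) x" "j \<in> c \<longleftrightarrow> j \<in> I \<and> b j \<le> inner (a j) y" for j
      using xy(3,4) unfolding p_def by blast+
    \<comment> \<open>The parameter at which the segment from \<open>x\<close> to \<open>y\<close>
      meets the hyperplane; the denominator is positive since only \<open>x\<close> violates
      constraint \<open>i\<close>.\<close>
    define u where "u = (b i - inner (a i) x) / (inner (a i) y - inner (a i) x)"
    have xi: "inner (a i) x < b i" "b i \<le> inner (a i) y" "x \<in> S" "y \<in> S"
      using xy by (auto simp: S0_def S1_def)
    have u: "0 \<le> u" "u \<le> 1" using xi by (auto simp: u_def field_simps)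
    define z where "z = (1 - u) *\<^sub>R x + u *\<^sub>R y"
    have inz: "inner (a j) z = (1 - u) * inner (a j) x + u * inner (a j) y" for j
      by (simp add: z_def inner_add_right)
    have "z \<in> S" unfolding z_def
      using \<open>affine S\<close> xi by (auto simp: affine_def)
    moreover have "inner (a i) z = b i"
    proof -
      have "u * (inner (a i) y - inner (a i) x) = b i - inner (a i) x"
        using xi by (simp add: u_def)
      then show ?thesis unfolding inz by (simp add: algebra_simps)
    qed
    moreover have "b j \<le> inner (a j) z" if "j \<in> c" for j
    proof -
      have "b j \<le> inner (a j) x" "b j \<le> inner (a j) y"
        using c[of j] that by blast+
      then have "(1 - u) * b j + u * b j \<le> (1 - u) * inner (a j) x + u * inner (a j) y"
        using u by (intro add_mono mult_left_mono) auto
      then show ?thesis unfolding inz by (simp add: left_diff_distrib)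
    qed
    moreover have "inner (a j) z < b j" if "j \<in> I" "j \<notin> c" for j
    proof -
      have lt: "inner (a j) x < b j" "inner (a j) y < b j"
        using c[of j] that by (auto simp: not_le)
      show ?thesis unfolding inz
        using convex_bound_lt[OF lt, of "1 - u" u] u by simp
    qed
    moreover have "c \<subseteq> I" using xy by (auto simp: p_def)
    ultimately have "p z = c" "z \<in> H"
      unfolding p_def H_def by (auto simp: not_le[symmetric])
    then show "c \<in> p ` H" by blast
  qed
  have "real (card (p ` S0 \<inter> p ` S1)) \<le> s * ((1 + s) ^ card I / s ^ k)"
  proof (cases "p ` S0 \<inter> p ` S1 = {}")
    case True
    then show ?thesis using s by simp
  next
    case False
    \<comment> \<open>A point of \<open>S0\<close> lies off the hyperplane, so the section loses
      exactly one dimension; being nonempty, it also forces \<open>k\<close> to be positive.\<close>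
    then have "S0 \<noteq> {}" "H \<noteq> {}" using sub by auto
    then have "\<not> S \<subseteq> {v. inner (a i) v = b i}" by (auto simp: S0_def)
    then have dimH: "aff_dim H = aff_dim S - 1"
      using aff_dim_affine_Int_hyperplane[OF insert.prems(1), of "a i" "b i"] \<open>H \<noteq> {}\<close>
      by (simp add: H_def)
    moreover have "0 \<le> aff_dim H"
      using \<open>H \<noteq> {}\<close> aff_dim_negative_iff linorder_not_less by blast
    ultimately obtain k' where k': "k = Suc k'"
      using insert.prems(2) by (cases k) auto
    have "affine H" unfolding H_def
      by (intro affine_Int insert.prems affine_hyperplane)
    have "card (p ` S0 \<inter> p ` S1) \<le> card (p ` H)"
      by (rule card_mono[OF fin sub])
    also have "real (card (p ` H)) \<le> (1 + s) ^ card I / s ^ k'"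
      unfolding p_def using dimH insert.prems(2) k'
      by (intro insert.IH[OF \<open>affine H\<close>]) simp
    finally show ?thesis using s by (simp add: k')
  qed
  with card_le Sk have "real (card ((\<lambda>x. {j\<in>insert i I. b j \<le> inner (a j) x}) ` S))
      \<le> (1 + s) ^ card I / s ^ k + s * ((1 + s) ^ card I / s ^ k)"
    by linarith
  also have "\<dots> = (1 + s) ^ card (insert i I) / s ^ k"
    using insert.hyps by (simp add: distrib_right add_divide_distrib)
  finally show ?case .
qed

subsection \<open>Farkas' lemma and extreme rays\<close>

text \<open>By induction on the number of rows. Either the first \<open>n\<close> rows already imply
  \<open>c\<close>, and the last multiplier is 0, or some point satisfies them with \<open>c\<close>
  negative. That point must violate row \<open>n\<close>, and projecting along it eliminates this
  row.\<close>

lemma farkas_sums: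
  fixes A :: "nat \<Rightarrow> nat \<Rightarrow> real" and c :: "nat \<Rightarrow> real"
  assumes "\<And>x. (\<forall>i<n. 0 \<le> (\<Sum>k<m. A i k * x k)) \<Longrightarrow> 0 \<le> (\<Sum>k<m. c k * x k)"
  shows "\<exists>l. (\<forall>i<n. 0 \<le> l i) \<and> (\<forall>k<m. c k = (\<Sum>i<n. l i * A i k))"
  using assms
proof (induction n arbitrary: A c)
  case 0
  \<comment> \<open>Without rows the hypothesis applies to every vector, in particular to
    \<open>- c\<close>.\<close>
  have "0 \<le> (\<Sum>k<m. c k * - c k)" by (rule 0) simp
  then have "(\<Sum>k<m. (c k)\<^sup>2) \<le> 0"
    by (simp add: sum_negf power2_eq_square)
  then have "(\<Sum>k<m. (c k)\<^sup>2) = 0"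
    by (intro antisym sum_nonneg) auto
  then have "\<forall>k<m. c k = 0" by (simp add: sum_nonneg_eq_0_iff)
  then show ?case by simp
next
  case (Suc n)
  let ?ip = "\<lambda>u x :: nat \<Rightarrow> real. \<Sum>k<m. u k * x k"
  show ?case
  proof (cases "\<forall>x. (\<forall>i<n. 0 \<le> ?ip (A i) x) \<longrightarrow> 0 \<le> ?ip c x")
    case True
    then obtain l where l: "\<forall>i<n. 0 \<le> l i" "\<forall>k<m. c k = (\<Sum>i<n. l i * A i k)"
      using Suc.IH[of A c] by blast
    then have "(\<forall>i<Suc n. 0 \<le> (l(n := 0)) i) \<and>
        (\<forall>k<m. c k = (\<Sum>i<Suc n. (l(n := 0)) i * A i k))"
      by (auto simp: less_Suc_eq)
    then show ?thesis by blast
  next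
    case False
    then obtain x0 where x0: "\<forall>i<n. 0 \<le> ?ip (A i) x0" "?ip c x0 < 0" by (auto simp: not_le)
    have neg: "?ip (A n) x0 < 0"
    proof (rule ccontr)
      assume "\<not> ?thesis"
      with x0(1) have "\<forall>i<Suc n. 0 \<le> ?ip (A i) x0" by (auto simp: less_Suc_eq)
      from Suc.prems[OF this] x0(2) show False by simp
    qed
    define t where "t = - 1 / ?ip (A n) x0"
    have t: "0 < t" using neg by (simp add: t_def)
    define x1 where "x1 = (\<lambda>k. t * x0 k)"
    have ip1: "?ip u x1 = t * ?ip u x0" for u
      by (simp add: x1_def sum_distrib_left mult_ac)
    have x1: "\<forall>i<n. 0 \<le> ?ip (A i) x1" "?ip c x1 < 0" "?ip (A n) x1 = -1"
    proof -
      show "\<forall>i<n. 0 \<le> ?ip (A i) x1" "?ip c x1 < 0"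
        unfolding ip1 using x0 t by (simp_all add: mult_pos_neg)
      show "?ip (A n) x1 = -1" unfolding ip1 using neg by (simp add: t_def)
    qed
    \<comment> \<open>As row \<open>n\<close> has value -1 at \<open>x1\<close>, the map from
      \<open>x\<close> to \<open>x + (A n x) x1\<close> projects onto the kernel of row
      \<open>n\<close>; \<open>P u\<close> is \<open>u\<close> composed with this
      projection.\<close>
    define P where "P = (\<lambda>u k. u k + A n k * ?ip u x1)"
    have ipP: "?ip (P u) x = ?ip u (\<lambda>k. x k + ?ip (A n) x * x1 k)" for u x
    proof -
      define t t' where "t = ?ip u x1" and "t' = ?ip (A n) x"
      have "?ip (P u) x = ?ip u x + t' * t"
        unfolding P_def t_def[symmetric] t'_def distrib_right sum.distrib sum_distrib_right
        by (simp add: mult_ac)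
      also have "\<dots> = ?ip u (\<lambda>k. x k + t' * x1 k)"
        by (simp add: t_def ring_distribs sum.distrib sum_distrib_left mult_ac)
      also have "\<dots> = ?ip u (\<lambda>k. x k + ?ip (A n) x * x1 k)" unfolding t'_def ..
      finally show ?thesis .
    qed
    have "0 \<le> ?ip (P c) x" if "\<forall>i<n. 0 \<le> ?ip (P (A i)) x" for x
    proof -
      let ?y = "\<lambda>k. x k + ?ip (A n) x * x1 k"
      have "?ip (A n) (\<lambda>k. x k + t' * x1 k) = ?ip (A n) x + t' * ?ip (A n) x1" for t'
        by (simp add: ring_distribs sum.distrib sum_distrib_left mult_ac)
      then have "?ip (A n) ?y = 0" unfolding x1(3) by simp
      then have "0 \<le> ?ip c ?y"
        using that by (intro Suc.prems) (auto simp: ipP less_Suc_eq)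
      then show ?thesis by (simp add: ipP)
    qed
    then obtain l where l: "\<forall>i<n. 0 \<le> l i" "\<forall>k<m. P c k = (\<Sum>i<n. l i * P (A i) k)"
      using Suc.IH[of "\<lambda>i. P (A i)" "P c"] by blast
    \<comment> \<open>Solving the identity for \<open>P c\<close> for \<open>c\<close> leaves this
      coefficient on row \<open>n\<close>. It is nonnegative because at \<open>x1\<close> the first
      \<open>n\<close> rows are nonnegative and \<open>c\<close> is negative.\<close>
    define r where "r = (\<Sum>i<n. l i * ?ip (A i) x1) - ?ip c x1"
    have "0 \<le> r"
    proof -
      have "0 \<le> (\<Sum>i<n. l i * ?ip (A i) x1)"
        using l(1) x1(1) by (auto intro!: sum_nonneg[of "{..<n}"] mult_nonneg_nonneg[of "l _"])
      then show ?thesis using x1(2) by (simp add: r_def)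
    qed
    moreover have "c k = (\<Sum>i<n. l i * A i k) + r * A n k" if "k < m" for k
    proof -
      have "c k + A n k * ?ip c x1 = (\<Sum>i<n. l i * (A i k + A n k * ?ip (A i) x1))"
        using l(2) that unfolding P_def by blast
      also have "\<dots> = (\<Sum>i<n. l i * A i k) + A n k * (\<Sum>i<n. l i * ?ip (A i) x1)"
      proof -
        have "(\<Sum>i<n. l i * (A i k + w * v i)) = (\<Sum>i<n. l i * A i k) + w * (\<Sum>i<n. l i * v i)" for w v
          by (simp add: distrib_left sum.distrib sum_distrib_left mult_ac)
        then show ?thesis .
      qed
      finally show ?thesis by (simp add: r_def algebra_simps)
    qed
    ultimately have "(\<forall>i<Suc n. 0 \<le> (l(n := r)) i) \<and>
        (\<forall>k<m. c k = (\<Sum>i<Suc n. (l(n := r)) i * A i k))"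
      using l by (auto simp: less_Suc_eq)
    then show ?thesis by blast
  qed
qed

lemma mem_dual_cone_iff:
  assumes "W \<in> carrier_mat m n"
  shows "a \<in> dual_cone W \<longleftrightarrow> a \<in> carrier_vec m \<and> (\<forall>j<n. 0 \<le> scalar_prod (col W j) a)"
  using assms by (auto simp: dual_cone_def less_eq_vec_def)

lemma scalar_prod_add_smult:
  fixes w u v :: "real Matrix.vec"
  assumes "w \<in> carrier_vec m" "u \<in> carrier_vec m" "v \<in> carrier_vec m"
  shows "scalar_prod w (u + t \<cdot>\<^sub>v v) = scalar_prod w u + t * scalar_prod w v"
  using assms by (simp add: scalar_prod_add_distrib)

lemma add_smult_scalar_prod:
  fixes w u v :: "real Matrix.vec"
  assumes "w \<in> carrier_vec m" "u \<in> carrier_vec m" "v \<in> carrier_vec m"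
  shows "scalar_prod (u + t \<cdot>\<^sub>v v) w = scalar_prod u w + t * scalar_prod v w"
  using assms by (simp add: add_scalar_prod_distrib)

text \<open>Descent on the number of slack constraints: a vector that spans no extreme ray is a
  nonnegative combination of two cone members with fewer slack constraints, and one of them keeps a
  negative product with \<open>b\<close>. Pointedness ensures that nonzero members have a slack
  constraint.\<close>

lemma exists_extreme_ray_scalar_prod_neg:
  assumes W: "W \<in> carrier_mat m n" and b: "b \<in> carrier_vec m"
    and pointed: "\<And>a. a \<in> carrier_vec m \<Longrightarrow> (\<And>j. j < n \<Longrightarrow> scalar_prod (col W j) a = 0) \<Longrightarrow> a = 0\<^sub>v m"
    and "a \<in> dual_cone W" "scalar_prod a b < 0"
  shows "\<exists>r. spans_extreme_ray (dual_cone W) r \<and> scalar_prod r b < 0"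
  using assms(4,5)
proof (induction "card {j. j < n \<and> 0 < scalar_prod (col W j) a}" arbitrary: a rule: less_induct)
  case less
  define \<phi> where "\<phi> = (\<lambda>j. scalar_prod (col W j))"
  define N where "N = (\<lambda>a. {j. j < n \<and> 0 < \<phi> j a})"
  have cone: "v \<in> dual_cone W \<longleftrightarrow> v \<in> carrier_vec m \<and> (\<forall>j<n. 0 \<le> \<phi> j v)" for v
    by (simp add: mem_dual_cone_iff[OF W] \<phi>_def)
  have colW: "col W j \<in> carrier_vec m" for j using W by (simp add: carrier_vecI)
  have lin: "\<phi> j (u + t \<cdot>\<^sub>v v) = \<phi> j u + t * \<phi> j v"
    if "u \<in> carrier_vec m" "v \<in> carrier_vec m" for j t u v
    unfolding \<phi>_def using scalar_prod_add_smult[OF colW that] .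
  have finN: "finite (N v)" for v by (simp add: N_def)
  have IH: "\<exists>r. spans_extreme_ray (dual_cone W) r \<and> scalar_prod r b < 0"
    if "v \<in> dual_cone W" "scalar_prod v b < 0" "N v \<subseteq> N a - {j}" "j \<in> N a" for v j
  proof (rule less.hyps)
    have "N v \<subset> N a" using that by blast
    then have "card (N v) < card (N a)" by (rule psubset_card_mono[OF finN])
    then show "card {j. j < n \<and> 0 < scalar_prod (col W j) v}
        < card {j. j < n \<and> 0 < scalar_prod (col W j) a}"
      by (simp add: N_def \<phi>_def)
  qed (use that in auto)
  have a: "a \<in> carrier_vec m" "\<And>j. j < n \<Longrightarrow> 0 \<le> \<phi> j a"
    using less.prems(1) by (auto simp: cone)
  have N_ne: "N v \<noteq> {}" if "v \<in> dual_cone W" "v \<noteq> 0\<^sub>v m" for v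
  proof
    assume "N v = {}"
    then have "scalar_prod (col W j) v = 0" if "j < n" for j
      using that \<open>v \<in> dual_cone W\<close> unfolding cone N_def \<phi>_def
      by (metis (mono_tags, lifting) empty_Collect_eq order_less_le)
    then show False using pointed[of v] that by (auto simp: cone)
  qed
  have a0: "a \<noteq> 0\<^sub>v m" using less.prems(2) b by auto
  show ?case
  proof (cases "spans_extreme_ray (dual_cone W) a")
    case True
    then show ?thesis using less.prems by blast
  next
    case False
    then obtain u v where uv: "u \<in> dual_cone W" "v \<in> dual_cone W" "u + v = a"
      and nmult: "(\<nexists>s. 0 \<le> s \<and> u = s \<cdot>\<^sub>v a) \<or> (\<nexists>s. 0 \<le> s \<and> v = s \<cdot>\<^sub>v a)"
      using less.prems(1) a a0 unfolding spans_extreme_ray_def by auto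
    \<comment> \<open>Extremality may fail through either summand; exchanging them makes it the
      first.\<close>
    have "\<exists>u v. u \<in> dual_cone W \<and> v \<in> dual_cone W \<and> u + v = a \<and> (\<nexists>s. 0 \<le> s \<and> u = s \<cdot>\<^sub>v a)"
      using nmult
    proof
      assume "\<nexists>s. 0 \<le> s \<and> v = s \<cdot>\<^sub>v a"
      moreover have "v + u = a" using uv comm_add_vec[of v m u] by (auto simp: cone)
      ultimately show ?thesis using uv by blast
    qed (use uv in blast)
    then obtain u v where u: "u \<in> dual_cone W" and v: "v \<in> dual_cone W" and uva: "u + v = a"
      and nm: "\<And>s. 0 \<le> s \<Longrightarrow> u \<noteq> s \<cdot>\<^sub>v a" by blast
    have uc: "u \<in> carrier_vec m" "\<And>j. j < n \<Longrightarrow> 0 \<le> \<phi> j u" and vc: "v \<in> carrier_vec m" "\<And>j. j < n \<Longrightarrow> 0 \<le> \<phi> j v"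
      using u v by (auto simp: cone)
    \<comment> \<open>Constraints tight at \<open>a\<close> are therefore tight at \<open>u\<close>
      and at all combinations of the two.\<close>
    have ule: "\<phi> j u \<le> \<phi> j a" if "j < n" for j
      using vc(2)[OF that] lin[OF uc(1) vc(1), of j 1] uva vc(1) by simp
    \<comment> \<open>Subtracting from \<open>u\<close> the largest multiple of \<open>a\<close> that stays in the cone, and then from
      \<open>a\<close> the largest multiple of the result, writes \<open>a\<close> as a nonnegative combination of two
      members of the cone, each of which makes strictly more constraints tight.\<close>
    define s where "s = Min ((\<lambda>j. \<phi> j u / \<phi> j a) ` N a)"
    have "s \<in> (\<lambda>j. \<phi> j u / \<phi> j a) ` N a"
      unfolding s_def using finN N_ne[OF less.prems(1) a0] by (intro Min_in) auto
    then obtain j0 where j0: "j0 \<in> N a" "s = \<phi> j0 u / \<phi> j0 a" by blast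
    have s_le: "s \<le> \<phi> j u / \<phi> j a" if "j \<in> N a" for j
      unfolding s_def using finN that by (intro Min_le) auto
    have "0 \<le> s" using j0 uc(2) by (auto simp: N_def)
    define p where "p = u + (- s) \<cdot>\<^sub>v a"
    have pc: "p \<in> carrier_vec m" using uc a by (simp add: p_def)
    have \<phi>p: "\<phi> j p = \<phi> j u - s * \<phi> j a" for j
      unfolding p_def using lin[OF uc(1) a(1)] by simp
    have zero: "\<phi> j a = 0" "\<phi> j u = 0" if "j < n" "j \<notin> N a" for j
      using that a(2)[of j] uc(2)[of j] ule[of j] by (auto simp: N_def)
    have "0 \<le> \<phi> j p" if "j < n" for j
    proof (cases "j \<in> N a")
      case True
      then show ?thesis using s_le[OF True] by (simp add: \<phi>p N_def field_simps)
    qed (use zero that in \<open>simp add: \<phi>p\<close>)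
    then have p: "p \<in> dual_cone W" using pc by (simp add: cone)
    have Np: "N p \<subseteq> N a - {j0}"
    proof
      fix j assume j: "j \<in> N p"
      have "j \<in> N a"
      proof (rule ccontr)
        assume "j \<notin> N a"
        with zero[of j] j show False by (simp add: N_def \<phi>p)
      qed
      moreover have "j \<noteq> j0" using j j0 by (auto simp: N_def \<phi>p)
      ultimately show "j \<in> N a - {j0}" by blast
    qed
    \<comment> \<open>Needed for the second minimum to range over a nonempty set;
      \<open>p = 0\<close> would make \<open>u\<close> a nonnegative multiple of
      \<open>a\<close>.\<close>
    have "p \<noteq> 0\<^sub>v m"
    proof
      assume p0: "p = 0\<^sub>v m"
      have "u = s \<cdot>\<^sub>v a"
      proof (rule eq_vecI)
        fix i assume i: "i < dim_vec (s \<cdot>\<^sub>v a)"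
        then have "vec_index p i = 0" using p0 a by simp
        then show "vec_index u i = vec_index (s \<cdot>\<^sub>v a) i"
          using i a uc by (simp add: p_def)
      qed (use a uc in simp)
      with nm[OF \<open>0 \<le> s\<close>] show False by simp
    qed
    show ?thesis
    proof (cases "scalar_prod p b < 0")
      case True
      then show ?thesis using IH[OF p _ Np j0(1)] by blast
    next
      case False
      define t where "t = Min ((\<lambda>j. \<phi> j a / \<phi> j p) ` N p)"
      have "t \<in> (\<lambda>j. \<phi> j a / \<phi> j p) ` N p"
        unfolding t_def using finN N_ne[OF p \<open>p \<noteq> 0\<^sub>v m\<close>] by (intro Min_in) auto
      then obtain j1 where j1: "j1 \<in> N p" "t = \<phi> j1 a / \<phi> j1 p" by blast
      have t_le: "t \<le> \<phi> j a / \<phi> j p" if "j \<in> N p" for j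
        unfolding t_def using finN that by (intro Min_le) auto
      have j1a: "j1 \<in> N a" using j1 Np by blast
      have "0 < t" using j1 j1a by (auto simp: N_def)
      define q where "q = a + (- t) \<cdot>\<^sub>v p"
      have qc: "q \<in> carrier_vec m" using pc a by (simp add: q_def)
      have \<phi>q: "\<phi> j q = \<phi> j a - t * \<phi> j p" for j
        unfolding q_def using lin[OF a(1) pc] by simp
      have "0 \<le> \<phi> j q" if "j < n" for j
      proof (cases "j \<in> N p")
        case True
        then show ?thesis using t_le[OF True] by (simp add: \<phi>q N_def field_simps)
      next
        case False
        then have "\<phi> j p = 0" using that p by (force simp: N_def cone)
        then show ?thesis using a(2)[OF that] by (simp add: \<phi>q)
      qed
      then have q: "q \<in> dual_cone W" using qc by (simp add: cone)
      have Nq: "N q \<subseteq> N a - {j1}"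
      proof
        fix j assume j: "j \<in> N q"
        have "j \<in> N a"
        proof (rule ccontr)
          assume "j \<notin> N a"
          with zero[of j] j show False by (simp add: N_def \<phi>q \<phi>p)
        qed
        moreover have "j \<noteq> j1" using j j1 by (auto simp: N_def \<phi>q)
        ultimately show "j \<in> N a - {j1}" by blast
      qed
      \<comment> \<open>Here \<open>a = q + t p\<close> with \<open>p\<close> nonnegative against
        \<open>b\<close>, so the negativity of \<open>a\<close> passes to \<open>q\<close>.\<close>
      have "scalar_prod q b = scalar_prod a b - t * scalar_prod p b"
        unfolding q_def using add_smult_scalar_prod[OF b a(1) pc] by simp
      moreover have "0 \<le> t * scalar_prod p b" using \<open>0 < t\<close> False by simp
      ultimately have "scalar_prod q b < 0" using less.prems(2) by linarith
      then show ?thesis using IH[OF q _ Nq j1a] by blast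
    qed
  qed
qed

text \<open>This yields pointedness of the dual cone: a nonzero vector orthogonal to all columns of
  \<open>W\<close> would be a linear dependence among its rows.\<close>

lemma rows_lin_indpt_imp_transpose_injective:
  assumes W: "W \<in> carrier_mat m n" and li: "rows_lin_indpt W"
    and a: "a \<in> carrier_vec m" "\<And>j. j < n \<Longrightarrow> scalar_prod (col W j) a = 0"
  shows "a = 0\<^sub>v m"
proof (rule ccontr)
  assume "a \<noteq> 0\<^sub>v m"
  interpret vec_space "TYPE(real)" n .
  have "transpose_mat W *\<^sub>v a = 0\<^sub>v n" using W a by (intro eq_vecI) auto
  then have "lin_dep (set (cols (transpose_mat W)))"
    using W a \<open>a \<noteq> 0\<^sub>v m\<close> li
    by (intro lin_depI[of _ m a]) (auto simp: rows_lin_indpt_def)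
  then show False using li W by (simp add: rows_lin_indpt_def)
qed

lemma farkas_mat:
  fixes W :: "real mat"
  assumes W: "W \<in> carrier_mat m n" and b: "b \<in> carrier_vec m"
    and nonneg: "\<And>a. a \<in> dual_cone W \<Longrightarrow> 0 \<le> scalar_prod a b"
  shows "\<exists>y\<in>carrier_vec n. 0\<^sub>v n \<le> y \<and> W *\<^sub>v y = b"
proof -
  have ip: "(\<Sum>k<m. vec_index u k * x k) = scalar_prod u (Matrix.vec m x)" for u x
    by (simp add: scalar_prod_def atLeast0LessThan)
  have "0 \<le> (\<Sum>k<m. vec_index b k * x k)"
    if "\<forall>j<n. 0 \<le> (\<Sum>k<m. vec_index (col W j) k * x k)" for x
  proof -
    have "Matrix.vec m x \<in> dual_cone W" using that by (simp add: mem_dual_cone_iff[OF W] ip)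
    from nonneg[OF this] show ?thesis
      using b by (simp add: ip comm_scalar_prod[of b m])
  qed
  then obtain l where l: "\<forall>j<n. 0 \<le> l j" "\<forall>k<m. vec_index b k = (\<Sum>j<n. l j * vec_index (col W j) k)"
    using farkas_sums[where n = n and m = m and A = "\<lambda>j. vec_index (col W j)" and c = "vec_index b"] by blast
  have "W *\<^sub>v Matrix.vec n l = b"
    using W b l by (intro eq_vecI) (auto simp: scalar_prod_def atLeast0LessThan mult.commute)
  then show ?thesis using l(1) by (intro bexI[of _ "Matrix.vec n l"]) (auto simp: less_eq_vec_def)
qed

text \<open>Eliminates the continuous recourse. Farkas' lemma reduces solvability to a test on the
  whole dual cone, and a failing test can be moved to an extreme ray; the other direction is weak
  duality.\<close>

lemma conic_system_solvable_iff:
  assumes W: "W \<in> carrier_mat m n" and li: "rows_lin_indpt W" and b: "b \<in> carrier_vec m"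
  shows "(\<exists>y\<in>carrier_vec n. 0\<^sub>v n \<le> y \<and> W *\<^sub>v y = b) \<longleftrightarrow>
         (\<forall>r. spans_extreme_ray (dual_cone W) r \<longrightarrow> 0 \<le> scalar_prod r b)"
proof
  assume "\<exists>y\<in>carrier_vec n. 0\<^sub>v n \<le> y \<and> W *\<^sub>v y = b"
  then obtain y where y: "y \<in> carrier_vec n" "0\<^sub>v n \<le> y" "W *\<^sub>v y = b" by blast
  have "0 \<le> scalar_prod r b" if "r \<in> dual_cone W" for r
  proof -
    have r: "r \<in> carrier_vec m" "\<And>j. j < n \<Longrightarrow> 0 \<le> scalar_prod (col W j) r"
      using that by (auto simp: mem_dual_cone_iff[OF W])
    have "scalar_prod r b = scalar_prod (transpose_mat W *\<^sub>v r) y"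
      using transpose_vec_mult_scalar[OF W y(1) r(1)] y(3) by simp
    also have "\<dots> = (\<Sum>j<n. scalar_prod (col W j) r * vec_index y j)"
      unfolding scalar_prod_def[of _ y] using W y(1)
      by (intro sum.cong) (auto simp: atLeast0LessThan)
    also have "\<dots> \<ge> 0"
      using r y by (intro sum_nonneg mult_nonneg_nonneg) (auto simp: less_eq_vec_def)
    finally show ?thesis .
  qed
  then show "\<forall>r. spans_extreme_ray (dual_cone W) r \<longrightarrow> 0 \<le> scalar_prod r b"
    by (auto simp: spans_extreme_ray_def)
next
  assume rays: "\<forall>r. spans_extreme_ray (dual_cone W) r \<longrightarrow> 0 \<le> scalar_prod r b"
  have "0 \<le> scalar_prod a b" if a: "a \<in> dual_cone W" for a
  proof (rule ccontr)
    assume "\<not> 0 \<le> scalar_prod a b"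
    then obtain r where "spans_extreme_ray (dual_cone W) r" "scalar_prod r b < 0"
      using exists_extreme_ray_scalar_prod_neg[OF W b rows_lin_indpt_imp_transpose_injective[OF W li] a]
      by (auto simp: not_le)
    then show False using rays by (simp add: not_le[symmetric])
  qed
  then show "\<exists>y\<in>carrier_vec n. 0\<^sub>v n \<le> y \<and> W *\<^sub>v y = b" by (rule farkas_mat[OF W b])
qed

text \<open>Positive scaling does not change the sign of a scalar product, so one vector per
  half-line suffices. This turns the tests into as many inequalities as there are rays.\<close>

lemma ex_ray_representatives:
  assumes C: "C \<subseteq> carrier_vec m"
  shows "\<exists>\<rho>. (\<forall>r\<in>extreme_rays C. \<rho> r \<in> carrier_vec m) \<and>
    (\<forall>b\<in>carrier_vec m. (\<forall>a. spans_extreme_ray C a \<longrightarrow> 0 \<le> scalar_prod a b) \<longleftrightarrow>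
       (\<forall>r\<in>extreme_rays C. 0 \<le> scalar_prod (\<rho> r) b))"
proof -
  define \<rho> where "\<rho> = (\<lambda>r. SOME a. spans_extreme_ray C a \<and> r = {t \<cdot>\<^sub>v a | t. t > 0})"
  have \<rho>: "spans_extreme_ray C (\<rho> r) \<and> r = {t \<cdot>\<^sub>v \<rho> r | t. t > 0}" if "r \<in> extreme_rays C" for r
    unfolding \<rho>_def by (rule someI_ex) (use that in \<open>auto simp: extreme_rays_def\<close>)
  have dim: "\<rho> r \<in> carrier_vec m" if "r \<in> extreme_rays C" for r
    using \<rho>[OF that] C by (auto simp: spans_extreme_ray_def)
  have imp: "0 \<le> scalar_prod a b"
    if nn: "\<forall>r\<in>extreme_rays C. 0 \<le> scalar_prod (\<rho> r) b" and a: "spans_extreme_ray C a"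
      and b: "b \<in> carrier_vec m" for a b
  proof -
    define r where "r = {t \<cdot>\<^sub>v a | t. t > 0}"
    have r: "r \<in> extreme_rays C" using a by (auto simp: r_def extreme_rays_def)
    have "a \<in> r" unfolding r_def by (intro CollectI exI[of _ 1]) (simp add: one_smult_vec)
    then obtain t where t: "t > 0" "a = t \<cdot>\<^sub>v \<rho> r" using \<rho>[OF r] by blast
    have "scalar_prod a b = t * scalar_prod (\<rho> r) b"
      unfolding t(2) using dim[OF r] b by simp
    then show ?thesis using nn r t(1) by simp
  qed
  show ?thesis
  proof (intro exI[of _ \<rho>] conjI ballI)
    fix b :: "real Matrix.vec" assume b: "b \<in> carrier_vec m"
    show "(\<forall>a. spans_extreme_ray C a \<longrightarrow> 0 \<le> scalar_prod a b) \<longleftrightarrow>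
          (\<forall>r\<in>extreme_rays C. 0 \<le> scalar_prod (\<rho> r) b)"
      using imp[OF _ _ b] \<rho>[THEN conjunct1] by blast
  qed (rule dim)
qed

subsection \<open>Polyhedral description of the second-stage feasible set\<close>

text \<open>Depends on the constraints only, hence is polyhedral in \<open>x\<close> for every
  scenario, whereas an infinite value may also come from \<open>g\<close> on a null set of
  scenarios.\<close>

definition recourse_feasible ::
  "nat \<Rightarrow> nat Matrix.vec set \<Rightarrow> real mat \<Rightarrow> real mat \<Rightarrow> (real ^ 'n::finite) Matrix.vec
    \<Rightarrow> real Matrix.vec \<Rightarrow> real ^ 'n \<Rightarrow> bool" where
  "recourse_feasible n' Z W W0 T h x \<longleftrightarrow>
     (\<exists>y\<in>carrier_vec n'. \<exists>y0\<in>Z. 0\<^sub>v n' \<le> y \<and>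
        W *\<^sub>v y + W0 *\<^sub>v map_vec real y0 + map_vec (\<lambda>t. inner t x) T = h)"

lemma second_stage_value_infeasible:
  assumes "\<not> recourse_feasible n' Z W W0 T h x"
  shows "second_stage_value n' Z W W0 T h g x = \<infinity>"
proof -
  have "{g y y0 | y y0. y \<in> carrier_vec n' \<and> 0\<^sub>v n' \<le> y \<and> y0 \<in> Z \<and>
      W *\<^sub>v y + W0 *\<^sub>v map_vec real y0 + map_vec (\<lambda>t. inner t x) T = h} = {}"
    using assms unfolding recourse_feasible_def by blast
  then show ?thesis by (simp only: second_stage_value_def Inf_empty top_ereal_def)
qed

lemma second_stage_value_eq_infinityD:
  assumes inf: "second_stage_value n' Z W W0 T h g x = \<infinity>" and Z: "Z \<subseteq> carrier_vec p'"
    and g: "\<forall>y\<in>carrier_vec n'. \<forall>y0\<in>carrier_vec p'. \<bar>g y y0\<bar> \<noteq> \<infinity>"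
  shows "\<not> recourse_feasible n' Z W W0 T h x"
proof
  assume "recourse_feasible n' Z W W0 T h x"
  then obtain y y0 where y: "y \<in> carrier_vec n'" "y0 \<in> Z" "0\<^sub>v n' \<le> y"
    "W *\<^sub>v y + W0 *\<^sub>v map_vec real y0 + map_vec (\<lambda>t. inner t x) T = h"
    unfolding recourse_feasible_def by blast
  then have "second_stage_value n' Z W W0 T h g x \<le> g y y0"
    unfolding second_stage_value_def by (intro Inf_lower) blast
  then have "g y y0 = \<infinity>" using inf by simp
  then show False using g y Z by fastforce
qed

lemma scalar_prod_map_vec_inner:
  assumes "r \<in> carrier_vec m" "T \<in> carrier_vec m"
  shows "scalar_prod r (map_vec (\<lambda>t. inner t x) T) =
         inner (\<Sum>k<m. vec_index r k *\<^sub>R vec_index T k) x"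
  using assms by (simp add: scalar_prod_def inner_sum_left atLeast0LessThan)

lemma recourse_feasible_halfspaces:
  fixes T :: "(real ^ 'n::finite) Matrix.vec"
  assumes W: "W \<in> carrier_mat m n'" and W0: "W0 \<in> carrier_mat m p'" and T: "T \<in> carrier_vec m"
    and h: "h \<in> carrier_vec m" and Z: "Z \<subseteq> carrier_vec p'" and li: "rows_lin_indpt W"
  obtains \<alpha> \<beta> where "\<And>x. recourse_feasible n' Z W W0 T h x \<longleftrightarrow>
      (\<exists>y0\<in>Z. \<forall>r\<in>extreme_rays (dual_cone W). \<beta> y0 r \<le> inner (\<alpha> r) x)"
proof -
  have "dual_cone W \<subseteq> carrier_vec m" using W by (auto simp: dual_cone_def)
  from ex_ray_representatives[OF this]
  obtain \<rho> where \<rho>_all: "(\<forall>r\<in>extreme_rays (dual_cone W). \<rho> r \<in> carrier_vec m) \<and>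
    (\<forall>b\<in>carrier_vec m. (\<forall>a. spans_extreme_ray (dual_cone W) a \<longrightarrow> 0 \<le> scalar_prod a b) \<longleftrightarrow>
       (\<forall>r\<in>extreme_rays (dual_cone W). 0 \<le> scalar_prod (\<rho> r) b))" ..
  note dim = \<rho>_all[THEN conjunct1, rule_format] and \<rho> = \<rho>_all[THEN conjunct2, THEN bspec]
  \<comment> \<open>These come from solving \<open>\<rho> r . (h - W0 y0 - T x) \<ge> 0\<close> for
    the part linear in \<open>x\<close>. The normal does not depend on \<open>y0\<close>, only the
    offset does.\<close>
  define \<alpha> where "\<alpha> = (\<lambda>r. - (\<Sum>k<m. vec_index (\<rho> r) k *\<^sub>R vec_index T k))"
  define \<beta> where "\<beta> = (\<lambda>y0 r. - scalar_prod (\<rho> r) (h - W0 *\<^sub>v map_vec real y0))"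
  have "(\<exists>y\<in>carrier_vec n'. 0\<^sub>v n' \<le> y \<and>
          W *\<^sub>v y + W0 *\<^sub>v map_vec real y0 + map_vec (\<lambda>t. inner t x) T = h) \<longleftrightarrow>
        (\<forall>r\<in>extreme_rays (dual_cone W). \<beta> y0 r \<le> inner (\<alpha> r) x)" if y0: "y0 \<in> Z" for x y0
  proof -
    define c where "c = W0 *\<^sub>v map_vec real y0"
    define b where "b = h - c - map_vec (\<lambda>t. inner t x) T"
    have c: "c \<in> carrier_vec m" unfolding c_def using W0 by (intro carrier_vecI) simp
    have b: "b \<in> carrier_vec m" unfolding b_def using T by (intro carrier_vecI) simp
    have "W *\<^sub>v y + c + map_vec (\<lambda>t. inner t x) T = h \<longleftrightarrow> W *\<^sub>v y = b" for y
    proof -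
      have "W *\<^sub>v y \<in> carrier_vec m" using W by (intro carrier_vecI) simp
      then show ?thesis using W c h T unfolding b_def
        by (auto simp: Matrix.vec_eq_iff algebra_simps)
    qed
    then have "(\<exists>y\<in>carrier_vec n'. 0\<^sub>v n' \<le> y \<and> W *\<^sub>v y + c + map_vec (\<lambda>t. inner t x) T = h) \<longleftrightarrow>
        (\<exists>y\<in>carrier_vec n'. 0\<^sub>v n' \<le> y \<and> W *\<^sub>v y = b)" by simp
    also have "\<dots> \<longleftrightarrow> (\<forall>r\<in>extreme_rays (dual_cone W). 0 \<le> scalar_prod (\<rho> r) b)"
      by (simp add: conic_system_solvable_iff[OF W li b] \<rho>[OF b])
    also have "\<dots> \<longleftrightarrow> (\<forall>r\<in>extreme_rays (dual_cone W). \<beta> y0 r \<le> inner (\<alpha> r) x)"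
    proof (rule ball_cong[OF refl])
      fix r assume "r \<in> extreme_rays (dual_cone W)"
      note r = dim[OF this]
      have "scalar_prod (\<rho> r) b = scalar_prod (\<rho> r) (h - c) - scalar_prod (\<rho> r) (map_vec (\<lambda>t. inner t x) T)"
        unfolding b_def using r h c T by (intro scalar_prod_minus_distrib) auto
      also have "\<dots> = inner (\<alpha> r) x - \<beta> y0 r"
        by (simp add: scalar_prod_map_vec_inner[OF r T] \<alpha>_def \<beta>_def c_def)
      finally show "0 \<le> scalar_prod (\<rho> r) b \<longleftrightarrow> \<beta> y0 r \<le> inner (\<alpha> r) x" by simp
    qed
    finally show ?thesis unfolding c_def .
  qed
  then show ?thesis
    by (intro that[of \<beta> \<alpha>]) (unfold recourse_feasible_def, blast)
qed

text \<open>The set of violated indices is a function of the sign pattern of all inequalities taken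
  together, so sign patterns bound the number of such sets.\<close>

lemma card_traces_union_of_polyhedra:
  fixes feas :: "'q \<Rightarrow> 'e::euclidean_space \<Rightarrow> bool" and R :: "'q \<Rightarrow> 'r set" and Z :: "'z set"
    and a :: "'q \<Rightarrow> 'r \<Rightarrow> 'e" and b :: "'q \<Rightarrow> 'z \<Rightarrow> 'r \<Rightarrow> real"
  assumes fin: "finite Q" "finite Z" "\<And>q. q \<in> Q \<Longrightarrow> finite (R q)"
    and card: "\<And>q. q \<in> Q \<Longrightarrow> card (R q) \<le> J" and s: "0 < s" "s \<le> 1"
    and feas: "\<And>q x. q \<in> Q \<Longrightarrow> feas q x \<longleftrightarrow> (\<exists>z\<in>Z. \<forall>r\<in>R q. b q z r \<le> inner (a q r) x)"
  shows "real (card (range (\<lambda>x. {q\<in>Q. \<not> feas q x})))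
      \<le> (1 + s) ^ (card Q * (card Z * J)) / s ^ DIM('e)"
proof -
  define K where "K = Sigma Q (\<lambda>q. Z \<times> R q)"
  define p where "p = (\<lambda>x. {i\<in>K. (case i of (q, z, r) \<Rightarrow> b q z r) \<le> inner (case i of (q, z, r) \<Rightarrow> a q r) x})"
  define G where "G = (\<lambda>P. {q\<in>Q. \<not> (\<exists>z\<in>Z. \<forall>r\<in>R q. (q, z, r) \<in> P)})"
  have finK: "finite K" using fin by (auto simp: K_def)
  have "card K = (\<Sum>q\<in>Q. card Z * card (R q))"
    unfolding K_def using fin by (subst card_SigmaI) (auto simp: card_cartesian_product)
  also have "\<dots> \<le> (\<Sum>q\<in>Q. card Z * J)" using card by (intro sum_mono mult_left_mono) auto
  finally have cardK: "card K \<le> card Q * (card Z * J)" by simp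
  have "{q\<in>Q. \<not> feas q x} = G (p x)" for x
  proof -
    have "feas q x \<longleftrightarrow> (\<exists>z\<in>Z. \<forall>r\<in>R q. (q, z, r) \<in> p x)" if "q \<in> Q" for q
      unfolding feas[OF that] using that by (intro bex_cong ball_cong refl) (simp add: p_def K_def)
    then show ?thesis unfolding G_def by blast
  qed
  then have "range (\<lambda>x. {q\<in>Q. \<not> feas q x}) = G ` range p" by (auto simp: image_image)
  moreover have "finite (range p)"
    by (rule finite_subset[of _ "Pow K"]) (use finK in \<open>auto simp: p_def\<close>)
  ultimately have "real (card (range (\<lambda>x. {q\<in>Q. \<not> feas q x}))) \<le> real (card (range p))"
    using card_image_le[of "range p" G] by simp
  also have "\<dots> \<le> (1 + s) ^ card K / s ^ DIM('e)"
    unfolding p_def by (rule card_sign_patterns[OF finK s]) auto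
  also have "\<dots> \<le> (1 + s) ^ (card Q * (card Z * J)) / s ^ DIM('e)"
    using s cardK by (intro divide_right_mono power_increasing) auto
  finally show ?thesis .
qed

subsection \<open>Double sampling\<close>

text \<open>An involution that exchanges the \<open>i\<close>-th scenarios of the two samples
  exactly for \<open>i\<close> in \<open>T\<close>; summing over all \<open>T\<close> below
  \<open>N\<close> plays the role of independent fair coin flips.\<close>

definition half_swap :: "nat \<Rightarrow> nat set \<Rightarrow> nat \<Rightarrow> nat" where
  "half_swap N T j = (if j < N then (if j \<in> T then N + j else j)
                      else if j < 2 * N \<and> j - N \<in> T then j - N else j)"

lemma half_swap_permutation:
  "inj_on (half_swap N T) {..<2 * N}" "half_swap N T \<in> {..<2 * N} \<rightarrow> {..<2 * N}"
proof -
  have "half_swap N T (half_swap N T j) = j" if "j < 2 * N" for j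
    using that by (auto simp: half_swap_def split: if_splits)
  then show "inj_on (half_swap N T) {..<2 * N}"
    by (intro inj_on_inverseI[where g = "half_swap N T"]) simp
  show "half_swap N T \<in> {..<2 * N} \<rightarrow> {..<2 * N}"
    by (auto simp: half_swap_def)
qed

text \<open>Giving a swapped sample the weight \<open>2\<^sup>k\<close>, where \<open>k\<close> counts the hits in its second half,
  compensates exactly for the probability \<open>2\<^sup>-\<^sup>k\<close> that a random swap removes all hits from the first
  half.\<close>

lemma sum_half_swap_weights_le:
  "(\<Sum>T\<in>Pow {..<N}. if \<forall>i<N. half_swap N T i \<notin> C
      then 2 ^ card {i. i < N \<and> half_swap N T (N + i) \<in> C} else 0) \<le> (2 ^ N :: nat)"
proof -
  define C1 where "C1 = {i. i < N \<and> i \<in> C}"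
  define C2 where "C2 = {i. i < N \<and> N + i \<in> C}"
  define E where "E = C1 \<union> C2"
  define \<T> where "\<T> = {T\<in>Pow {..<N}. \<forall>i<N. half_swap N T i \<notin> C}"
  have E: "E \<subseteq> {..<N}" "finite E"
    using finite_subset[of E "{..<N}"] by (auto simp: E_def C1_def C2_def)
  \<comment> \<open>A swap that clears the first half must move every hit of \<open>C1\<close> away
    and leave every hit of \<open>C2\<close> in place, so it is free only outside \<open>E\<close>,
    and all of \<open>E\<close> ends up hit in the second half.\<close>
  have sep: "C1 \<subseteq> T" "C2 \<inter> T = {}" if "T \<in> \<T>" for T
    using that by (auto simp: \<T>_def C1_def C2_def half_swap_def split: if_splits)
  have hits: "{i. i < N \<and> half_swap N T (N + i) \<in> C} = E" if "T \<in> \<T>" for T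
    using sep[OF that] by (auto simp: C1_def C2_def E_def half_swap_def)
  have "inj_on (\<lambda>T. T - E) \<T>"
  proof (rule inj_onI)
    fix T U assume "T \<in> \<T>" "U \<in> \<T>" "T - E = U - E"
    then show "T = U" using sep[of T] sep[of U] unfolding E_def by blast
  qed
  moreover have "(\<lambda>T. T - E) ` \<T> \<subseteq> Pow ({..<N} - E)" by (auto simp: \<T>_def)
  ultimately have "card \<T> \<le> card (Pow ({..<N} - E))"
    by (intro card_inj_on_le[of "\<lambda>T. T - E"]) auto
  then have card: "card \<T> \<le> 2 ^ (N - card E)"
    using E by (simp add: card_Pow card_Diff_subset)
  have "(\<Sum>T\<in>Pow {..<N}. if \<forall>i<N. half_swap N T i \<notin> C
      then 2 ^ card {i. i < N \<and> half_swap N T (N + i) \<in> C} else 0)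
    = (\<Sum>T\<in>\<T>. 2 ^ card {i. i < N \<and> half_swap N T (N + i) \<in> C} :: nat)"
    unfolding \<T>_def by (rule sum.inter_filter[symmetric]) simp
  also have "\<dots> = card \<T> * 2 ^ card E" using hits by simp
  also have "\<dots> \<le> 2 ^ (N - card E) * 2 ^ card E" using card by simp
  also have "\<dots> = 2 ^ N"
    using card_mono[OF _ E(1)] by (simp flip: power_add)
  finally show ?thesis .
qed

lemma (in prob_space) distr_half_swap:
  "distr (\<Pi>\<^sub>M j\<in>{..<2 * N}. M) (\<Pi>\<^sub>M j\<in>{..<2 * N}. M) (\<lambda>z. \<lambda>j\<in>{..<2 * N}. z (half_swap N T j))
     = (\<Pi>\<^sub>M j\<in>{..<2 * N}. M)"
  using distr_PiM_reindex[of "{..<2 * N}" "\<lambda>_. M", OF prob_space_axioms half_swap_permutation] .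

text \<open>Both bounds concern the integral of \<open>2 ^ k\<close> over the event
  \<open>S\<close>, with \<open>k\<close> the number of hits of the second sample at
  \<open>x\<close>. Violation appears twice: \<open>B\<close> is a measurable part of it carrying
  enough mass at the selected point, while \<open>A\<close> is full violation, used only pointwise
  in counting traces and so free of measurability conditions.\<close>

lemma (in prob_space) double_sampling_bound:
  fixes A :: "'a \<Rightarrow> 'x \<Rightarrow> bool" and \<epsilon> D :: real
  defines "P \<equiv> \<lambda>N :: nat. \<Pi>\<^sub>M i\<in>{..<N}. M"
  assumes S[measurable]: "S \<in> sets (P N)" and x[measurable]: "x \<in> measurable (P N) L"
    and B[measurable]: "B \<in> sets (M \<Otimes>\<^sub>M L)" and \<epsilon>: "0 \<le> \<epsilon>"
    and BA: "\<And>w v. (w, v) \<in> B \<Longrightarrow> A w v"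
    and avoid: "\<And>\<omega> i. \<omega> \<in> S \<Longrightarrow> i < N \<Longrightarrow> \<not> A (\<omega> i) (x \<omega>)"
    and mass: "AE \<omega> in P N. \<omega> \<in> S \<longrightarrow> ennreal \<epsilon> \<le> emeasure M {w\<in>space M. (w, x \<omega>) \<in> B}"
    and traces: "\<And>z. z \<in> {..<2 * N} \<rightarrow> space M \<Longrightarrow>
      real (card (range (\<lambda>v. {j\<in>{..<2 * N}. A (z j) v}))) \<le> D"
  shows "measure (P N) S * (1 + \<epsilon>) ^ N \<le> D"
proof -
  interpret PS: product_prob_space "\<lambda>_. M" "{..<N}" by standard
  interpret PN: prob_space "P N" unfolding P_def by (rule prob_space_PiM) (rule prob_space_axioms)
  interpret P2: prob_space "P (2 * N)" unfolding P_def by (rule prob_space_PiM) (rule prob_space_axioms)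
  define fst_half where "fst_half = (\<lambda>z :: nat \<Rightarrow> 'a. restrict z {..<N})"
  have fst_half[measurable]: "fst_half \<in> measurable (P (2 * N)) (P N)"
    unfolding P_def fst_half_def by (rule measurable_restrict_subset) auto
  have comp[measurable]: "(\<lambda>z. z (N + i)) \<in> measurable (P (2 * N)) M" if "i < N" for i
    unfolding P_def using that by (intro measurable_component_singleton) auto
  \<comment> \<open>Writing \<open>2 ^ k\<close> as a product of factors 1 or 2 lets the integral
    factorise over the second sample.\<close>
  define G :: "(nat \<Rightarrow> 'a) \<Rightarrow> ennreal" where
    "G = (\<lambda>z. indicator S (fst_half z) * (\<Prod>i<N. 1 + indicator B (z (N + i), x (fst_half z))))"
  have G[measurable]: "G \<in> borel_measurable (P (2 * N))"
    unfolding G_def by measurable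
  have G_eq: "G z = (if fst_half z \<in> S then 2 ^ card {i. i < N \<and> (z (N + i), x (fst_half z)) \<in> B} else 0)" for z
  proof -
    have "(\<Prod>i<N. 1 + indicator B (z (N + i), x (fst_half z)) :: ennreal)
      = (\<Prod>i<N. if (z (N + i), x (fst_half z)) \<in> B then 2 else 1)"
      by (intro prod.cong) (auto simp: indicator_def)
    also have "\<dots> = (\<Prod>i\<in>{i\<in>{..<N}. (z (N + i), x (fst_half z)) \<in> B}. 2)"
      by (rule prod.inter_filter[symmetric]) simp
    finally show ?thesis by (simp add: G_def indicator_def)
  qed

  \<comment> \<open>With the first sample fixed, \<open>x\<close> is fixed, and each of the
    \<open>N\<close> independent factors has mean at least \<open>1 + \<epsilon>\<close> on
    \<open>S\<close>.\<close>
  have lower: "ennreal (measure (P N) S * (1 + \<epsilon>) ^ N) \<le> (\<integral>\<^sup>+z. G z \<partial>P (2 * N))"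
  proof -
    have un: "{..<N} \<union> {N..<2 * N} = {..<2 * N}" by auto
    have "(\<integral>\<^sup>+z. G z \<partial>P (2 * N)) =
        (\<integral>\<^sup>+\<omega>. (\<integral>\<^sup>+y. G (merge {..<N} {N..<2 * N} (\<omega>, y)) \<partial>Pi\<^sub>M {N..<2 * N} (\<lambda>_. M)) \<partial>P N)"
      using PS.product_nn_integral_fold[of "{..<N}" "{N..<2 * N}" G] G unfolding P_def un
      by (simp add: ivl_disj_int)
    moreover have "ennreal (measure (P N) S * (1 + \<epsilon>) ^ N) = (\<integral>\<^sup>+\<omega>. indicator S \<omega> * ennreal ((1 + \<epsilon>) ^ N) \<partial>P N)"
      using \<epsilon> by (simp add: nn_integral_multc PN.emeasure_eq_measure ennreal_mult)
    moreover have "AE \<omega> in P N. indicator S \<omega> * ennreal ((1 + \<epsilon>) ^ N)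
        \<le> (\<integral>\<^sup>+y. G (merge {..<N} {N..<2 * N} (\<omega>, y)) \<partial>Pi\<^sub>M {N..<2 * N} (\<lambda>_. M))"
      using mass
    proof eventually_elim
      fix \<omega> assume mass: "\<omega> \<in> S \<longrightarrow> ennreal \<epsilon> \<le> emeasure M {w\<in>space M. (w, x \<omega>) \<in> B}"
      show "indicator S \<omega> * ennreal ((1 + \<epsilon>) ^ N)
        \<le> (\<integral>\<^sup>+y. G (merge {..<N} {N..<2 * N} (\<omega>, y)) \<partial>Pi\<^sub>M {N..<2 * N} (\<lambda>_. M))"
      proof (cases "\<omega> \<in> S")
        case True
        then have \<omega>: "\<omega> \<in> space (P N)" using sets.sets_into_space[OF S] by blast
        then have x\<omega>: "x \<omega> \<in> space L" using measurable_space[OF x] by blast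
        define F :: "'a \<Rightarrow> ennreal" where "F = (\<lambda>w. 1 + indicator B (w, x \<omega>))"
        have F[measurable]: "F \<in> borel_measurable M" unfolding F_def using x\<omega> by measurable
        have half: "fst_half (merge {..<N} {N..<2 * N} (\<omega>, y)) = \<omega>" for y
          using \<omega> by (auto simp: fst_half_def merge_def P_def space_PiM PiE_def extensional_def fun_eq_iff)
        have "G (merge {..<N} {N..<2 * N} (\<omega>, y)) = (\<Prod>j\<in>{N..<2 * N}. F (y j))" for y
        proof -
          have "G (merge {..<N} {N..<2 * N} (\<omega>, y)) = (\<Prod>i<N. F (y (N + i)))"
            unfolding G_def half F_def using True by (auto simp: merge_def intro!: prod.cong)
          also have "\<dots> = (\<Prod>j\<in>{N..<2 * N}. F (y j))"
            by (rule prod.reindex_bij_witness[of _ "\<lambda>j. j - N" "\<lambda>i. N + i"]) auto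
          finally show ?thesis .
        qed
        then have "(\<integral>\<^sup>+y. G (merge {..<N} {N..<2 * N} (\<omega>, y)) \<partial>Pi\<^sub>M {N..<2 * N} (\<lambda>_. M))
            = (\<integral>\<^sup>+w. F w \<partial>M) ^ N"
          using PS.product_nn_integral_prod[of "{N..<2 * N}" "\<lambda>_. F"] F by simp
        moreover have "ennreal (1 + \<epsilon>) \<le> (\<integral>\<^sup>+w. F w \<partial>M)"
        proof -
          have Bx: "{w\<in>space M. (w, x \<omega>) \<in> B} \<in> sets M" using x\<omega> by measurable
          have "(\<integral>\<^sup>+w. F w \<partial>M) = (\<integral>\<^sup>+w. 1 + indicator {w\<in>space M. (w, x \<omega>) \<in> B} w \<partial>M)"
            unfolding F_def by (intro nn_integral_cong) (auto simp: indicator_def)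
          also have "\<dots> = 1 + emeasure M {w\<in>space M. (w, x \<omega>) \<in> B}"
            using Bx by (subst nn_integral_add) (auto simp: emeasure_space_1)
          finally show ?thesis using mass True \<epsilon> by (simp add: ennreal_plus add_left_mono)
        qed
        ultimately show ?thesis using True \<epsilon>
          by (simp add: power_mono flip: ennreal_power)
      qed simp
    qed
    ultimately show ?thesis by (simp add: nn_integral_mono_AE)
  qed

  \<comment> \<open>Multiplying by \<open>2 ^ N\<close> replaces the average over swaps by a sum.
    Every swap preserves the product measure, so all \<open>2 ^ N\<close> integrals agree.\<close>
  have upper: "2 ^ N * (\<integral>\<^sup>+z. G z \<partial>P (2 * N)) \<le> 2 ^ N * ennreal D"
  proof -
    define \<sigma> where "\<sigma> = (\<lambda>T z. \<lambda>j\<in>{..<2 * N}. z (half_swap N T j) :: 'a)"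
    have \<sigma>[measurable]: "\<sigma> T \<in> measurable (P (2 * N)) (P (2 * N))" for T
      unfolding \<sigma>_def P_def using half_swap_permutation(2)[of N T]
      by (intro measurable_restrict measurable_component_singleton) auto
    have inv: "(\<integral>\<^sup>+z. G z \<partial>P (2 * N)) = (\<integral>\<^sup>+z. G (\<sigma> T z) \<partial>P (2 * N))" for T
    proof -
      have "distr (P (2 * N)) (P (2 * N)) (\<sigma> T) = P (2 * N)"
        unfolding P_def \<sigma>_def by (rule distr_half_swap)
      then show ?thesis using nn_integral_distr[OF \<sigma>[of T], of G] G by simp
    qed
    have "2 ^ N * (\<integral>\<^sup>+z. G z \<partial>P (2 * N)) = (\<Sum>T\<in>Pow {..<N}. \<integral>\<^sup>+z. G (\<sigma> T z) \<partial>P (2 * N))"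
      unfolding inv[symmetric] by (simp add: card_Pow)
    also have "\<dots> = (\<integral>\<^sup>+z. (\<Sum>T\<in>Pow {..<N}. G (\<sigma> T z)) \<partial>P (2 * N))"
      by (rule nn_integral_sum[symmetric]) measurable
    also have "\<dots> \<le> (\<integral>\<^sup>+z. 2 ^ N * ennreal D \<partial>P (2 * N))"
    proof (rule nn_integral_mono)
      fix z assume "z \<in> space (P (2 * N))"
      then have z: "z \<in> {..<2 * N} \<rightarrow> space M" by (auto simp: P_def space_PiM)
      define tr where "tr = (\<lambda>v. {j\<in>{..<2 * N}. A (z j) v})"
      define wt :: "nat set \<Rightarrow> nat set \<Rightarrow> nat" where
        "wt = (\<lambda>T C. if \<forall>i<N. half_swap N T i \<notin> C
           then 2 ^ card {i. i < N \<and> half_swap N T (N + i) \<in> C} else 0)"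
      have fin: "finite (range tr)"
        by (rule finite_subset[of _ "Pow {..<2 * N}"]) (auto simp: tr_def)
      have sw: "half_swap N T j < 2 * N" if "j < 2 * N" for T j
        using half_swap_permutation(2)[of N T] that by (auto simp: Pi_iff)
      \<comment> \<open>The selected point varies with \<open>T\<close>, but its trace always lies
        in \<open>range tr\<close>, which depends on \<open>z\<close> alone. Summing over all traces
        therefore removes the dependence of the point on the swap.\<close>
      have "G (\<sigma> T z) \<le> of_nat (\<Sum>C\<in>range tr. wt T C)" for T
      proof (cases "fst_half (\<sigma> T z) \<in> S")
        case True
        define v where "v = x (fst_half (\<sigma> T z))"
        have "half_swap N T i \<notin> tr v" if "i < N" for i
          using avoid[OF True that] that by (simp add: tr_def v_def fst_half_def \<sigma>_def)
        moreover have "card {i. i < N \<and> (\<sigma> T z (N + i), v) \<in> B}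
            \<le> card {i. i < N \<and> half_swap N T (N + i) \<in> tr v}"
          using BA sw by (intro card_mono) (auto simp: tr_def \<sigma>_def)
        ultimately have "G (\<sigma> T z) \<le> of_nat (wt T (tr v))"
          using True by (simp add: G_eq wt_def v_def power_increasing)
        also have "wt T (tr v) \<le> (\<Sum>C\<in>range tr. wt T C)"
          using fin by (intro member_le_sum) auto
        finally show ?thesis by (simp add: ennreal_of_nat_eq_real_of_nat)
      qed (simp add: G_eq)
      then have "(\<Sum>T\<in>Pow {..<N}. G (\<sigma> T z)) \<le> (\<Sum>T\<in>Pow {..<N}. of_nat (\<Sum>C\<in>range tr. wt T C))"
        by (intro sum_mono)
      also have "\<dots> = of_nat (\<Sum>T\<in>Pow {..<N}. \<Sum>C\<in>range tr. wt T C)" by simp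
      also have "(\<Sum>T\<in>Pow {..<N}. \<Sum>C\<in>range tr. wt T C) = (\<Sum>C\<in>range tr. \<Sum>T\<in>Pow {..<N}. wt T C)"
        by (rule sum.swap)
      also have "of_nat \<dots> \<le> ennreal (2 ^ N * D)"
      proof -
        have "(\<Sum>C\<in>range tr. \<Sum>T\<in>Pow {..<N}. wt T C) \<le> (\<Sum>C\<in>range tr. 2 ^ N)"
          unfolding wt_def by (intro sum_mono sum_half_swap_weights_le)
        then have "real (\<Sum>C\<in>range tr. \<Sum>T\<in>Pow {..<N}. wt T C) \<le> real (\<Sum>C\<in>range tr. 2 ^ N)"
          by (rule of_nat_mono)
        also have "\<dots> = 2 ^ N * real (card (range tr))" by simp
        also have "\<dots> \<le> 2 ^ N * D" using traces[OF z] by (simp add: tr_def)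
        finally show ?thesis by (simp add: ennreal_of_nat_eq_real_of_nat ennreal_leI)
      qed
      finally show "(\<Sum>T\<in>Pow {..<N}. G (\<sigma> T z)) \<le> 2 ^ N * ennreal D"
        by (simp add: ennreal_mult' ennreal_power[symmetric])
    qed
    also have "\<dots> = 2 ^ N * ennreal D" by (simp add: P2.emeasure_space_1)
    finally show ?thesis .
  qed
  have "ennreal (measure (P N) S * (1 + \<epsilon>) ^ N) \<le> ennreal D"
  proof -
    have "(2 :: ennreal) ^ N \<noteq> 0" "(2 :: ennreal) ^ N \<noteq> Orderings.top"
      by (simp_all add: power_eq_top_ennreal)
    then have "(\<integral>\<^sup>+z. G z \<partial>P (2 * N)) \<le> ennreal D"
      using upper by (simp add: ennreal_mult_le_mult_iff)
    then show ?thesis using lower by (rule order_trans[rotated])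
  qed
  \<comment> \<open>Needed to return from \<open>ennreal\<close> to reals; a constant double sample
    gives it.\<close>
  moreover have "0 \<le> D"
  proof -
    obtain w where "w \<in> space M" using not_empty by blast
    then have "real (card (range (\<lambda>v. {j\<in>{..<2 * N}. A w v}))) \<le> D"
      by (intro traces) auto
    then show ?thesis by (meson of_nat_0_le_iff order_trans)
  qed
  ultimately show ?thesis by simp
qed

subsection \<open>Completions\<close>

lemma completion_ex_borel_measurable_euclidean:
  fixes u :: "'a \<Rightarrow> 'e::euclidean_space"
  assumes "u \<in> borel_measurable (completion M)"
  shows "\<exists>v\<in>borel_measurable M. AE x in M. u x = v x"
proof -
  have "\<exists>v\<in>borel_measurable M. AE x in M. inner (u x) b = v x" for b
    using assms by (intro completion_ex_borel_measurable_real) simp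
  then obtain v where v[measurable]: "\<And>b. v b \<in> borel_measurable M"
    and ae: "\<And>b. AE x in M. inner (u x) b = v b x" by metis
  have "AE x in M. \<forall>b\<in>Basis. inner (u x) b = v b x"
    by (intro AE_finite_allI) (use ae in auto)
  then have "AE x in M. u x = (\<Sum>b\<in>Basis. v b x *\<^sub>R b)"
  proof eventually_elim
    case (elim x)
    have "u x = (\<Sum>b\<in>Basis. inner (u x) b *\<^sub>R b)" by (simp add: euclidean_representation)
    also have "\<dots> = (\<Sum>b\<in>Basis. v b x *\<^sub>R b)" using elim by (intro sum.cong) auto
    finally show ?case .
  qed
  moreover have "(\<lambda>x. \<Sum>b\<in>Basis. v b x *\<^sub>R b) \<in> borel_measurable M" by measurable
  ultimately show ?thesis by (rule bexI)
qed

text \<open>The infinity set is a measurable part plus a subset of a null set. By Fubini almost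
  every slice of that null set is null, and completeness of \<open>M\<close> then handles its
  subsets.\<close>

lemma completion_pair_infinity_slices:
  fixes \<phi> :: "'a \<times> 'b \<Rightarrow> ereal"
  assumes "sigma_finite_measure M" "complete_measure M" "sigma_finite_measure \<mu>"
    and \<phi>: "\<phi> \<in> borel_measurable (completion (M \<Otimes>\<^sub>M \<mu>))"
  shows "\<exists>B\<in>sets (M \<Otimes>\<^sub>M \<mu>). (\<forall>p\<in>B. \<phi> p = \<infinity>) \<and>
    (AE x in \<mu>. {w\<in>space M. \<phi> (w, x) = \<infinity>} - {w. (w, x) \<in> B} \<in> null_sets M)"
proof -
  interpret M: complete_measure M by fact
  interpret pair_sigma_finite M \<mu>
    by (intro pair_sigma_finite.intro assms)
  define F where "F = {p\<in>space (M \<Otimes>\<^sub>M \<mu>). \<phi> p = \<infinity>}"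
  have "\<phi> -` {\<infinity>} \<inter> space (completion (M \<Otimes>\<^sub>M \<mu>)) \<in> sets (completion (M \<Otimes>\<^sub>M \<mu>))"
    by (rule measurable_sets[OF \<phi>]) simp
  moreover have "\<phi> -` {\<infinity>} \<inter> space (completion (M \<Otimes>\<^sub>M \<mu>)) = F" by (auto simp: F_def)
  ultimately have F: "F \<in> sets (completion (M \<Otimes>\<^sub>M \<mu>))" by simp
  define B where "B = main_part (M \<Otimes>\<^sub>M \<mu>) F"
  obtain N0 where N0: "N0 \<in> null_sets (M \<Otimes>\<^sub>M \<mu>)" "null_part (M \<Otimes>\<^sub>M \<mu>) F \<subseteq> N0"
    using null_part[OF F] by blast
  have FB: "F = B \<union> null_part (M \<Otimes>\<^sub>M \<mu>) F"
    unfolding B_def using main_part_null_part_Un[OF F] by simp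
  have N0s: "N0 \<in> sets (M \<Otimes>\<^sub>M \<mu>)" using N0 by auto
  have "(\<integral>\<^sup>+x. emeasure M ((\<lambda>w. (w, x)) -` N0) \<partial>\<mu>) = 0"
    using emeasure_pair_measure_alt2[OF N0s] N0(1) by auto
  then have "AE x in \<mu>. emeasure M ((\<lambda>w. (w, x)) -` N0) = 0"
    by (subst (asm) nn_integral_0_iff_AE) (use measurable_emeasure_Pair2[OF N0s] in auto)
  then have "AE x in \<mu>. {w\<in>space M. \<phi> (w, x) = \<infinity>} - {w. (w, x) \<in> B} \<in> null_sets M"
    using AE_space
  proof eventually_elim
    case (elim x)
    have "(\<lambda>w. (w, x)) -` N0 \<in> null_sets M"
      using elim sets_Pair2[OF N0s] by (auto simp: null_sets_def)
    moreover have "{w\<in>space M. \<phi> (w, x) = \<infinity>} - {w. (w, x) \<in> B} \<subseteq> (\<lambda>w. (w, x)) -` N0"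
    proof
      fix w assume w: "w \<in> {w\<in>space M. \<phi> (w, x) = \<infinity>} - {w. (w, x) \<in> B}"
      then have "(w, x) \<in> F" using elim by (auto simp: F_def space_pair_measure)
      then show "w \<in> (\<lambda>w. (w, x)) -` N0" using w FB N0(2) by auto
    qed
    ultimately show ?case by (rule M.complete2[rotated])
  qed
  moreover have "B \<in> sets (M \<Otimes>\<^sub>M \<mu>)" unfolding B_def using F by simp
  moreover have "\<phi> p = \<infinity>" if "p \<in> B" for p
  proof -
    have "p \<in> F" using that FB by blast
    then show ?thesis by (simp add: F_def)
  qed
  ultimately show ?thesis by (intro bexI[of _ B] conjI ballI)
qed

text \<open>Uses the point mass at \<open>x\<close> as measure on \<open>X\<close>: a property of
  almost every point then holds at \<open>x\<close> itself.\<close>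

lemma completion_measurable_on_infinity_set:
  fixes \<phi> :: "'w \<times> 'a::topological_space \<Rightarrow> ereal"
  assumes M: "prob_space M" "complete_measure M" and X: "x \<in> X"
    and \<phi>: "completion_measurable_on M X \<phi>"
  shows "{w\<in>space M. \<phi> (w, x) = \<infinity>} \<in> sets M"
proof -
  interpret M: prob_space M by fact
  define \<mu> where "\<mu> = return (restrict_space borel X) x"
  have x: "x \<in> space (restrict_space borel X)" using X by (simp add: space_restrict_space)
  interpret \<mu>: prob_space \<mu> unfolding \<mu>_def using x by (rule prob_space_return)
  have "\<phi> \<in> borel_measurable (completion (M \<Otimes>\<^sub>M \<mu>))"
    using \<phi> \<mu>.prob_space_axioms unfolding completion_measurable_on_def by (simp add: \<mu>_def)
  from completion_pair_infinity_slices[OF M.sigma_finite_measure_axioms M(2) \<mu>.sigma_finite_measure_axioms this]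
  obtain B where B: "B \<in> sets (M \<Otimes>\<^sub>M \<mu>)" "\<forall>p\<in>B. \<phi> p = \<infinity>"
    and ae: "AE x in \<mu>. {w\<in>space M. \<phi> (w, x) = \<infinity>} - {w. (w, x) \<in> B} \<in> null_sets M"
    by blast
  from AE_E[OF ae] obtain N where N: "{x\<in>space \<mu>. \<not> {w\<in>space M. \<phi> (w, x) = \<infinity>} - {w. (w, x) \<in> B} \<in> null_sets M} \<subseteq> N"
    "emeasure \<mu> N = 0" "N \<in> sets \<mu>" by blast
  then have "x \<notin> N" by (auto simp: \<mu>_def indicator_def split: if_splits)
  moreover have "x \<in> space \<mu>" using x by (simp add: \<mu>_def)
  ultimately have diff: "{w\<in>space M. \<phi> (w, x) = \<infinity>} - {w. (w, x) \<in> B} \<in> sets M" using N(1) by auto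
  have Bx: "(\<lambda>w. (w, x)) -` B \<in> sets M" using sets_Pair2[OF B(1)] .
  have eq: "{w\<in>space M. \<phi> (w, x) = \<infinity>} =
      ({w\<in>space M. \<phi> (w, x) = \<infinity>} - {w. (w, x) \<in> B}) \<union> (\<lambda>w. (w, x)) -` B"
    using B(2) sets.sets_into_space[OF Bx] by auto
  show ?thesis by (subst eq) (rule sets.Un[OF diff Bx])
qed

lemma ext_expectation_less_infinity_imp_AE:
  fixes \<phi> :: "'w \<Rightarrow> ereal"
  assumes fin: "ext_expectation M \<phi> < \<infinity>" and meas: "{w\<in>space M. \<phi> w = \<infinity>} \<in> sets M"
  shows "AE w in M. \<phi> w < \<infinity>"
proof -
  let ?F = "{w\<in>space M. \<phi> w = \<infinity>}"
  \<comment> \<open>By the convention for the difference of infinities, an infinite positive part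
    would make the expectation infinite whatever the negative part.\<close>
  have "(\<integral>\<^sup>+w. e2ennreal (\<phi> w) \<partial>M) < \<infinity>"
    using fin unfolding ext_expectation_def
    by (cases "(\<integral>\<^sup>+w. e2ennreal (\<phi> w) \<partial>M) = \<infinity>") (auto simp: less_top)
  moreover have "\<infinity> * emeasure M ?F \<le> (\<integral>\<^sup>+w. e2ennreal (\<phi> w) \<partial>M)"
  proof -
    have "\<infinity> * emeasure M ?F = (\<integral>\<^sup>+w. \<infinity> * indicator ?F w \<partial>M)"
      using meas by (simp add: nn_integral_cmult_indicator)
    also have "\<dots> \<le> (\<integral>\<^sup>+w. e2ennreal (\<phi> w) \<partial>M)"
      by (intro nn_integral_mono) (auto simp: indicator_def)
    finally show ?thesis .
  qed
  ultimately have "emeasure M ?F = 0" by (auto simp: ennreal_top_mult split: if_splits)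
  then have "AE w in M. w \<notin> ?F" using meas by (intro AE_not_in) auto
  then show ?thesis using AE_space by eventually_elim auto
qed

subsection \<open>The convergence rate\<close>

text \<open>The graph of \<open>exp\<close> lies below its chord from 0 to \<open>2 / 3\<close>,
  whose right end is at most 2 since \<open>ln 2\<close> is at least \<open>2 / 3\<close>.\<close>

lemma exp_two_thirds_le:
  fixes \<epsilon> :: real
  assumes "0 \<le> \<epsilon>" "\<epsilon> \<le> 1"
  shows "exp (2 / 3 * \<epsilon>) \<le> 1 + \<epsilon>"
proof -
  have "exp (2 / 3 :: real) \<le> exp (ln 2)" using ln2_ge_two_thirds by (subst exp_le_cancel_iff)
  then have e2: "exp (2 / 3 :: real) \<le> 2" by simp
  have "exp ((1 - \<epsilon>) *\<^sub>R 0 + \<epsilon> *\<^sub>R (2 / 3)) \<le> (1 - \<epsilon>) * exp 0 + \<epsilon> * exp (2 / 3 :: real)"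
    using assms by (intro convex_onD[where A = UNIV and f = exp] exp_convex) auto
  also have "\<dots> \<le> (1 - \<epsilon>) + \<epsilon> * 2" using mult_left_mono[OF e2 assms(1)] by simp
  finally show ?thesis by (simp add: mult.commute)
qed

text \<open>Unless both sides vanish, the squared constant and both logarithms are at least
  1.\<close>

lemma vc_bound_ge: "real (nZ * nJ * n) \<le> vc_bound nZ nJ n"
proof (cases "nZ * nJ = 0")
  case False
  then have pos: "1 \<le> nZ" "1 \<le> nJ" by auto
  have ln2: "0 < ln (2 :: real)" "ln 2 \<le> (1 :: real)" using ln_le_minus_one[of 2] by auto
  have log_ge: "1 \<le> ln (exp 1 * real k / ln 2)" if "1 \<le> k" for k
  proof -
    have "ln 2 \<le> real k" using that ln2 by linarith
    then have "exp 1 * ln 2 \<le> exp 1 * real k" by (intro mult_left_mono) auto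
    then have "exp 1 \<le> exp 1 * real k / ln 2" using ln2 by (simp add: le_divide_eq)
    then have "ln (exp 1) \<le> ln (exp 1 * real k / ln 2)"
      by (intro ln_mono) auto
    then show ?thesis by simp
  qed
  have "(exp 1 - 1) * ln 2 \<le> (exp 1 - 1) * (1 :: real)" using ln2 by (intro mult_left_mono) auto
  also have "\<dots> \<le> exp 1" by simp
  finally have "(exp 1 - 1) * ln 2 \<le> (exp 1 :: real)" .
  moreover have "0 < (exp 1 - 1) * ln (2 :: real)" using ln2 by simp
  ultimately have "1 \<le> exp 1 / ((exp 1 - 1) * ln 2 :: real)" by (simp only: le_divide_eq_1_pos)
  then have c: "1 \<le> (exp 1 / ((exp 1 - 1) * ln 2 :: real))\<^sup>2" by (simp add: one_le_power)
  have "real (nZ * nJ * n) \<le> 1 * real nZ * real nJ * (real n + 2) * 1 * 1"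
    by (simp add: mult_left_mono)
  also have "\<dots> \<le> vc_bound nZ nJ n"
    unfolding vc_bound_def using c log_ge[OF pos(1)] log_ge[OF pos(2)]
    by (intro mult_mono) auto
  finally show ?thesis .
qed (auto simp: vc_bound_def)

lemma rate_from_growth_bound:
  fixes \<epsilon> p :: real
  assumes \<epsilon>: "0 < \<epsilon>" "\<epsilon> < 1" and p: "0 \<le> p"
    and growth: "\<And>s. 0 < s \<Longrightarrow> s \<le> 1 \<Longrightarrow>
      p * (1 + \<epsilon>) ^ N \<le> (1 + s) ^ (2 * N * (nZ * nJ)) / s ^ n"
  shows "p \<le> 2 * exp (- (real N * \<epsilon> / 4)) * (12 / \<epsilon>) powr vc_bound nZ nJ n"
proof -
  define q where "q = nZ * nJ"
  have "exp (2 / 3 * \<epsilon>) ^ N \<le> (1 + \<epsilon>) ^ N"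
    using exp_two_thirds_le[of \<epsilon>] \<epsilon> by (intro power_mono) auto
  then have e: "p * exp (2 / 3 * (real N * \<epsilon>)) \<le> p * (1 + \<epsilon>) ^ N"
    using p by (intro mult_left_mono) (simp_all add: mult_ac flip: exp_of_nat_mult)
  have "p * exp (2 / 3 * (real N * \<epsilon>)) \<le> exp (real N * \<epsilon> / 3) * (12 / \<epsilon>) ^ (q * n)"
  proof (cases "q = 0")
    \<comment> \<open>The choice of \<open>s\<close> below would divide by zero; with no
      inequalities \<open>s = 1\<close> already gives the bound 1.\<close>
    case True
    have "p * (1 + \<epsilon>) ^ N \<le> 1" using growth[of 1] True by (simp flip: q_def)
    also have "\<dots> \<le> exp (real N * \<epsilon> / 3)" using \<epsilon> by simp
    finally show ?thesis using e True by simp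
  next
    case False
    \<comment> \<open>Makes \<open>2 N q s = N \<epsilon> / 3\<close>, half of the exponent
      \<open>2 / 3\<close> gained on the left, leaving the rate \<open>1 / 3\<close>.\<close>
    define s where "s = \<epsilon> / (6 * real q)"
    have s: "0 < s" "s \<le> 1" using \<epsilon> False by (auto simp: s_def field_simps)
    have "(1 + s) ^ (2 * N * q) \<le> exp s ^ (2 * N * q)" using s by (intro power_mono) auto
    also have "\<dots> = exp (real N * \<epsilon> / 3)"
      using False by (simp add: s_def flip: exp_of_nat_mult)
    finally have num: "(1 + s) ^ (2 * N * q) \<le> exp (real N * \<epsilon> / 3)" .
    \<comment> \<open>Bernoulli's inequality, as \<open>12 / \<epsilon>\<close> is at least 2; this
      absorbs the factor \<open>q\<close> of \<open>1 / s\<close> into the power.\<close>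
    have "real q \<le> (12 / \<epsilon>) ^ (q - 1)"
    proof -
      have "1 + real (q - 1) * 1 \<le> 1 + real (q - 1) * (12 / \<epsilon> - 1)"
        using \<epsilon> by (intro add_left_mono mult_left_mono) (auto simp: field_simps)
      also have "\<dots> \<le> (1 + (12 / \<epsilon> - 1)) ^ (q - 1)"
        using \<epsilon> by (intro Bernoulli_inequality) auto
      finally show ?thesis using False by (simp add: of_nat_diff)
    qed
    then have "12 / \<epsilon> * real q \<le> 12 / \<epsilon> * (12 / \<epsilon>) ^ (q - 1)"
      using \<epsilon> by (intro mult_left_mono) auto
    also have "\<dots> = (12 / \<epsilon>) ^ q" using False by (simp flip: power_Suc)
    finally have "12 / \<epsilon> * real q \<le> (12 / \<epsilon>) ^ q" .
    moreover have "1 / s \<le> 12 / \<epsilon> * real q" using \<epsilon> False by (simp add: s_def field_simps)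
    ultimately have "1 / s \<le> (12 / \<epsilon>) ^ q" by linarith
    then have "(1 / s) ^ n \<le> ((12 / \<epsilon>) ^ q) ^ n" using s by (intro power_mono) auto
    then have den: "1 / s ^ n \<le> (12 / \<epsilon>) ^ (q * n)"
      by (simp add: power_one_over power_mult)
    have "p * (1 + \<epsilon>) ^ N \<le> (1 + s) ^ (2 * N * q) * (1 / s ^ n)"
      using growth[OF s] by (simp add: q_def)
    also have "\<dots> \<le> exp (real N * \<epsilon> / 3) * (12 / \<epsilon>) ^ (q * n)"
      using num den s by (intro mult_mono) auto
    finally show ?thesis using e by linarith
  qed
  then have "p * exp (2 / 3 * (real N * \<epsilon>)) * exp (- (2 / 3 * (real N * \<epsilon>)))
      \<le> exp (real N * \<epsilon> / 3) * (12 / \<epsilon>) ^ (q * n) * exp (- (2 / 3 * (real N * \<epsilon>)))"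
    by (rule mult_right_mono) simp
  also have "\<dots> = exp (- (real N * \<epsilon> / 3)) * (12 / \<epsilon>) ^ (q * n)"
    by (simp add: mult_ac flip: exp_add)
  finally have "p \<le> exp (- (real N * \<epsilon> / 3)) * (12 / \<epsilon>) ^ (q * n)"
    by (simp add: mult.assoc flip: exp_add)
  also have "\<dots> \<le> (2 * exp (- (real N * \<epsilon> / 4))) * (12 / \<epsilon>) powr vc_bound nZ nJ n"
  proof (rule mult_mono)
    have "exp (- (real N * \<epsilon> / 3)) \<le> exp (- (real N * \<epsilon> / 4))" using \<epsilon> by simp
    then show "exp (- (real N * \<epsilon> / 3)) \<le> 2 * exp (- (real N * \<epsilon> / 4))"
      using exp_ge_zero[of "- (real N * \<epsilon> / 4)"] by linarith
    have "(12 / \<epsilon>) ^ (q * n) = (12 / \<epsilon>) powr real (q * n)"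
      using \<epsilon> by (subst powr_realpow) auto
    also have "\<dots> \<le> (12 / \<epsilon>) powr vc_bound nZ nJ n"
      unfolding q_def using \<epsilon> vc_bound_ge by (intro powr_mono) auto
    finally show "(12 / \<epsilon>) ^ (q * n) \<le> (12 / \<epsilon>) powr vc_bound nZ nJ n" .
  qed (use \<epsilon> in auto)
  finally show ?thesis .
qed

lemma rate_imp_sample_complexity:
  fixes \<delta> \<epsilon> d :: real
  assumes "0 < \<delta>" "0 < \<epsilon>" "4 / \<epsilon> * (d * ln (12 / \<epsilon>) + ln (2 / \<delta>)) \<le> real N"
  shows "2 * exp (- (real N * \<epsilon> / 4)) * (12 / \<epsilon>) powr d \<le> \<delta>"
proof -
  have "d * ln (12 / \<epsilon>) + ln (2 / \<delta>) \<le> real N * \<epsilon> / 4"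
    using assms by (simp add: field_simps)
  then have "exp (- (real N * \<epsilon> / 4)) \<le> exp (- (d * ln (12 / \<epsilon>) + ln (2 / \<delta>)))" by simp
  also have "\<dots> = inverse ((12 / \<epsilon>) powr d) * (\<delta> / 2)"
  proof -
    have "exp (- (d * ln (12 / \<epsilon>) + ln (2 / \<delta>)))
        = inverse (exp (d * ln (12 / \<epsilon>))) * inverse (exp (ln (2 / \<delta>)))"
      by (simp only: exp_minus exp_add inverse_mult_distrib)
    then show ?thesis using assms(1,2) by (simp add: powr_def)
  qed
  finally have "exp (- (real N * \<epsilon> / 4)) * (12 / \<epsilon>) powr d
      \<le> inverse ((12 / \<epsilon>) powr d) * (\<delta> / 2) * (12 / \<epsilon>) powr d"
    by (rule mult_right_mono) simp
  also have "\<dots> = \<delta> / 2" using assms by simp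
  finally show ?thesis by simp
qed

subsection \<open>The violation probability of feasible solutions\<close>

text \<open>Scenarios are indexed by \<open>Q\<close> through \<open>\<zeta>\<close>, so repeated
  samples are allowed.\<close>

lemma card_recourse_traces:
  fixes T :: "'s \<Rightarrow> (real ^ 'n::finite) Matrix.vec"
  assumes Z: "Z \<subseteq> carrier_vec p'" "finite Z"
    and carrier: "\<And>\<zeta>. \<zeta> \<in> \<Xi> \<Longrightarrow> W \<zeta> \<in> carrier_mat (dim_row (W \<zeta>)) n'"
      "\<And>\<zeta>. \<zeta> \<in> \<Xi> \<Longrightarrow> W0 \<zeta> \<in> carrier_mat (dim_row (W \<zeta>)) p'"
      "\<And>\<zeta>. \<zeta> \<in> \<Xi> \<Longrightarrow> T \<zeta> \<in> carrier_vec (dim_row (W \<zeta>))"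
      "\<And>\<zeta>. \<zeta> \<in> \<Xi> \<Longrightarrow> h \<zeta> \<in> carrier_vec (dim_row (W \<zeta>))"
    and li: "\<And>\<zeta>. \<zeta> \<in> \<Xi> \<Longrightarrow> rows_lin_indpt (W \<zeta>)"
    and rays: "\<And>\<zeta>. \<zeta> \<in> \<Xi> \<Longrightarrow> finite (extreme_rays (dual_cone (W \<zeta>)))"
      "\<And>\<zeta>. \<zeta> \<in> \<Xi> \<Longrightarrow> card (extreme_rays (dual_cone (W \<zeta>))) \<le> J"
    and Q: "finite Q" "\<And>q. q \<in> Q \<Longrightarrow> \<zeta> q \<in> \<Xi>" and s: "0 < s" "s \<le> 1"
  shows "real (card (range (\<lambda>x. {q\<in>Q. \<not> recourse_feasible n' Z (W (\<zeta> q)) (W0 (\<zeta> q)) (T (\<zeta> q)) (h (\<zeta> q)) x})))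
      \<le> (1 + s) ^ (card Q * (card Z * J)) / s ^ CARD('n)"
proof -
  let ?feas = "\<lambda>q. recourse_feasible n' Z (W (\<zeta> q)) (W0 (\<zeta> q)) (T (\<zeta> q)) (h (\<zeta> q))"
  have "\<forall>q\<in>Q. \<exists>\<alpha> \<beta>. \<forall>x. ?feas q x \<longleftrightarrow>
      (\<exists>y0\<in>Z. \<forall>r\<in>extreme_rays (dual_cone (W (\<zeta> q))). \<beta> y0 r \<le> inner (\<alpha> r) x)"
  proof
    fix q assume "q \<in> Q"
    note \<zeta> = Q(2)[OF this]
    show "\<exists>\<alpha> \<beta>. \<forall>x. ?feas q x \<longleftrightarrow>
      (\<exists>y0\<in>Z. \<forall>r\<in>extreme_rays (dual_cone (W (\<zeta> q))). \<beta> y0 r \<le> inner (\<alpha> r) x)"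
      by (rule recourse_feasible_halfspaces[OF carrier(1-4)[OF \<zeta>] Z(1) li[OF \<zeta>]]) (intro exI allI)
  qed
  then obtain \<alpha> where "\<forall>q\<in>Q. \<exists>\<beta>. \<forall>x. ?feas q x \<longleftrightarrow>
      (\<exists>y0\<in>Z. \<forall>r\<in>extreme_rays (dual_cone (W (\<zeta> q))). \<beta> y0 r \<le> inner (\<alpha> q r) x)"
    unfolding bchoice_iff ..
  then obtain \<beta> where "\<forall>q\<in>Q. \<forall>x. ?feas q x \<longleftrightarrow>
      (\<exists>y0\<in>Z. \<forall>r\<in>extreme_rays (dual_cone (W (\<zeta> q))). \<beta> q y0 r \<le> inner (\<alpha> q r) x)"
    unfolding bchoice_iff ..
  then have "real (card (range (\<lambda>x. {q\<in>Q. \<not> ?feas q x})))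
      \<le> (1 + s) ^ (card Q * (card Z * J)) / s ^ DIM(real ^ 'n)"
    using Q Z rays s
    by (intro card_traces_union_of_polyhedra[where R = "\<lambda>q. extreme_rays (dual_cone (W (\<zeta> q)))"
          and a = \<alpha> and b = \<beta>]) auto
  then show ?thesis by simp
qed

theorem corollary4p8:
  fixes M :: "'w measure"
    and \<xi> :: "'w \<Rightarrow> real ^ 'r::finite"
    and \<Xi> :: "(real ^ 'r) set"
    and I :: "'n::finite set"
    and X :: "(real ^ 'n) set"
    and f0 :: "real ^ 'n \<Rightarrow> real"
    and n' p' :: nat
    and Z :: "nat Matrix.vec set"
    and W W0 :: "real ^ 'r \<Rightarrow> real mat"
    and T :: "real ^ 'r \<Rightarrow> (real ^ 'n) Matrix.vec"
    and h :: "real ^ 'r \<Rightarrow> real Matrix.vec"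
    and g :: "real ^ 'r \<Rightarrow> real Matrix.vec \<Rightarrow> nat Matrix.vec \<Rightarrow> ereal"
    and f :: "real ^ 'r \<Rightarrow> real ^ 'n \<Rightarrow> ereal"
    and J N :: nat
    and d :: real
    and xstar :: "(nat \<Rightarrow> real ^ 'r) \<Rightarrow> real ^ 'n"
  assumes "prob_space M" and "complete_measure M"
    and "\<xi> \<in> borel_measurable M" and "\<xi> \<in> space M \<rightarrow> \<Xi>"
    and "X \<subseteq> mixed_integer_space I" and "X \<noteq> {}" and "closed X"
    and "Z \<subseteq> carrier_vec p'"
    and "\<And>\<zeta>. \<zeta> \<in> \<Xi> \<Longrightarrow> W \<zeta> \<in> carrier_mat (dim_row (W \<zeta>)) n'"
    and "\<And>\<zeta>. \<zeta> \<in> \<Xi> \<Longrightarrow> W0 \<zeta> \<in> carrier_mat (dim_row (W \<zeta>)) p'"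
    and "\<And>\<zeta>. \<zeta> \<in> \<Xi> \<Longrightarrow> T \<zeta> \<in> carrier_vec (dim_row (W \<zeta>))"
    and "\<And>\<zeta>. \<zeta> \<in> \<Xi> \<Longrightarrow> h \<zeta> \<in> carrier_vec (dim_row (W \<zeta>))"
    and "\<And>\<zeta>. \<zeta> \<in> \<Xi> \<Longrightarrow> rows_lin_indpt (W \<zeta>)"
    and "AE \<omega> in M. \<forall>y\<in>carrier_vec n'. \<forall>y0\<in>carrier_vec p'. \<bar>g (\<xi> \<omega>) y y0\<bar> \<noteq> \<infinity>"
    and f_def: "f = (\<lambda>\<zeta>. second_stage_value n' Z (W \<zeta>) (W0 \<zeta>) (T \<zeta>) (h \<zeta>) (g \<zeta>))"
    and "\<And>\<zeta> x. \<zeta> \<in> \<Xi> \<Longrightarrow> x \<in> X \<Longrightarrow> f \<zeta> x \<noteq> -\<infinity>"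
    and "\<And>\<zeta>. \<zeta> \<in> \<Xi> \<Longrightarrow> lsc_on X (f \<zeta>)"
    and "completion_measurable_on M X (\<lambda>(\<omega>, x). f (\<xi> \<omega>) x)"
    and "\<exists>x\<in>X. ereal (f0 x) + ext_expectation M (\<lambda>\<omega>. f (\<xi> \<omega>) x) < \<infinity>"
    and "finite Z"
    and "\<And>\<zeta>. \<zeta> \<in> \<Xi> \<Longrightarrow> finite (extreme_rays (dual_cone (W \<zeta>)))"
    and "finite ((\<lambda>\<zeta>. card (extreme_rays (dual_cone (W \<zeta>)))) ` \<Xi>)"
    and J_def: "J = Max ((\<lambda>\<zeta>. card (extreme_rays (dual_cone (W \<zeta>)))) ` \<Xi>)"
    and xstar_feasible: "\<And>s. s \<in> {..<N} \<rightarrow>\<^sub>E \<Xi> \<Longrightarrow> saa_feasible X f N s \<noteq> {} \<Longrightarrow>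
           xstar s \<in> saa_feasible X f N s"
    and "(\<lambda>\<omega>. xstar (iid_sample \<xi> N \<omega>)) \<in> borel_measurable (sample_space M N)"
    and d_def: "d = vc_bound (card Z) J CARD('n)"
  shows "(\<forall>\<delta> \<epsilon>. 0 < \<delta> \<and> \<delta> < 1 \<and> 0 < \<epsilon> \<and> \<epsilon> < 1 \<and>
            real N \<ge> 4 / \<epsilon> * (d * ln (12 / \<epsilon>) + ln (2 / \<delta>)) \<longrightarrow>
            measure (sample_space M N) {\<omega> \<in> space (sample_space M N).
              violation_prob M \<xi> f (xstar (iid_sample \<xi> N \<omega>)) > \<epsilon>} \<le> \<delta>)
       \<and> (\<forall>\<epsilon>. 0 < \<epsilon> \<and> \<epsilon> < 1 \<longrightarrow>
            measure (sample_space M N) {\<omega> \<in> space (sample_space M N).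
              violation_prob M \<xi> f (xstar (iid_sample \<xi> N \<omega>)) > \<epsilon>}
              \<le> 2 * exp (- (real N * \<epsilon> / 4)) * (12 / \<epsilon>) powr d)"
proof -
  interpret M: prob_space M by fact
  define P where "P = (\<Pi>\<^sub>M i\<in>{..<N}. M)"
  interpret P: prob_space P unfolding P_def by (rule prob_space_PiM) (rule M.prob_space_axioms)
  have sample: "sample_space M N = completion P" by (simp add: sample_space_def P_def)
  define L where "L = restrict_space borel X"
  note \<xi> = \<open>\<xi> \<in> space M \<rightarrow> \<Xi>\<close>
  have \<xi>_in: "\<xi> w \<in> \<Xi>" if "w \<in> space M" for w using \<xi> that by blast
  define feas where "feas = (\<lambda>\<zeta>. recourse_feasible n' Z (W \<zeta>) (W0 \<zeta>) (T \<zeta>) (h \<zeta>))"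
  define \<phi> where "\<phi> = (\<lambda>(w, y). f (\<xi> w) y)"
  have \<phi>: "completion_measurable_on M X \<phi>" using assms(18) by (simp add: \<phi>_def)
  have cardJ: "card (extreme_rays (dual_cone (W \<zeta>))) \<le> J" if "\<zeta> \<in> \<Xi>" for \<zeta>
    unfolding J_def using assms(22) that by (intro Max_ge) auto
  have infeas: "f \<zeta> y = \<infinity>" if "\<not> feas \<zeta> y" for \<zeta> y
    unfolding f_def by (rule second_stage_value_infeasible) (use that in \<open>simp add: feas_def\<close>)

  define g_finite where
    "g_finite = (\<lambda>w. \<forall>y\<in>carrier_vec n'. \<forall>y0\<in>carrier_vec p'. \<bar>g (\<xi> w) y y0\<bar> \<noteq> \<infinity>)"
  obtain Ng where Ng: "{w\<in>space M. \<not> g_finite w} \<subseteq> Ng" "emeasure M Ng = 0" "Ng \<in> sets M"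
    using AE_E[OF assms(14)[folded g_finite_def]] by blast
  have not_feas: "\<not> feas (\<xi> w) y" if "w \<in> space M" "w \<notin> Ng" "f (\<xi> w) y = \<infinity>" for w y
  proof -
    have "g_finite w" using Ng(1) that(1,2) by blast
    then show ?thesis
      using second_stage_value_eq_infinityD[OF that(3)[unfolded f_def] \<open>Z \<subseteq> carrier_vec p'\<close>]
      by (simp add: feas_def g_finite_def)
  qed

  \<comment> \<open>Almost sure feasibility of the output\<close>
  obtain x0 where x0: "x0 \<in> X" "ereal (f0 x0) + ext_expectation M (\<lambda>\<omega>. f (\<xi> \<omega>) x0) < \<infinity>"
    using assms(19) by blast
  have "AE w in M. f (\<xi> w) x0 < \<infinity>"
  proof (rule ext_expectation_less_infinity_imp_AE)
    show "ext_expectation M (\<lambda>\<omega>. f (\<xi> \<omega>) x0) < \<infinity>" using x0(2) by auto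
    show "{w\<in>space M. f (\<xi> w) x0 = \<infinity>} \<in> sets M"
      using completion_measurable_on_infinity_set[OF assms(1,2) x0(1) \<phi>] by (simp add: \<phi>_def)
  qed
  \<comment> \<open>The point \<open>x0\<close> is almost surely feasible for all \<open>N\<close>
    samples, so the SAA region is nonempty and the guarantee of the algorithm applies.\<close>
  then have "AE \<omega> in P. \<forall>i\<in>{..<N}. f (\<xi> (\<omega> i)) x0 < \<infinity>"
    unfolding P_def by (intro AE_finite_allI AE_PiM_component) (auto intro: M.prob_space_axioms)
  then have feasible: "AE \<omega> in P. xstar (iid_sample \<xi> N \<omega>) \<in> saa_feasible X f N (iid_sample \<xi> N \<omega>)"
    using AE_space
  proof eventually_elim
    case (elim \<omega>)
    then have "iid_sample \<xi> N \<omega> \<in> {..<N} \<rightarrow>\<^sub>E \<Xi>"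
      using \<xi>_in by (auto simp: iid_sample_def P_def space_PiM)
    moreover have "x0 \<in> saa_feasible X f N (iid_sample \<xi> N \<omega>)"
      using elim x0(1) by (auto simp: saa_feasible_def iid_sample_def)
    ultimately show ?case using xstar_feasible by blast
  qed

  \<comment> \<open>Borel version of the output and measurable violation set\<close>
  define u where "u = (\<lambda>\<omega>. xstar (iid_sample \<xi> N \<omega>))"
  have "u \<in> borel_measurable (completion P)" using assms(25) by (simp add: u_def sample)
  then obtain u' where u'[measurable]: "u' \<in> borel_measurable P" and uu': "AE \<omega> in P. u \<omega> = u' \<omega>"
    using completion_ex_borel_measurable_euclidean by blast
  \<comment> \<open>The default \<open>x0\<close> keeps all values in \<open>X\<close>; almost
    surely it is not taken, as \<open>u\<close> is feasible.\<close>
  define v where "v = (\<lambda>\<omega>. if u' \<omega> \<in> X then u' \<omega> else x0)"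
  have Xs[measurable]: "X \<in> sets borel" using \<open>closed X\<close> by (rule borel_closed)
  have v[measurable]: "v \<in> measurable P L"
    unfolding L_def
  proof (rule measurable_restrict_space2)
    show "v \<in> space P \<rightarrow> X" using x0 by (auto simp: v_def)
    show "v \<in> borel_measurable P" unfolding v_def by measurable
  qed
  have "AE \<omega> in P. u \<omega> \<in> saa_feasible X f N (iid_sample \<xi> N \<omega>) \<and> u \<omega> = v \<omega>"
    using feasible uu' by eventually_elim (auto simp: u_def v_def saa_feasible_def)
  from AE_E[OF this] obtain N1 where N1:
    "{\<omega>\<in>space P. \<not> (u \<omega> \<in> saa_feasible X f N (iid_sample \<xi> N \<omega>) \<and> u \<omega> = v \<omega>)} \<subseteq> N1"
    "emeasure P N1 = 0" "N1 \<in> sets P" by blast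

  \<comment> \<open>Taking the law of \<open>v\<close> itself makes exceptional points of
    \<open>X\<close> negligible exactly where the output is evaluated.\<close>
  define \<mu> where "\<mu> = distr P L v"
  interpret \<mu>: prob_space \<mu> unfolding \<mu>_def by (rule P.prob_space_distr) (rule v)
  have sets_\<mu>: "sets \<mu> = sets L" by (simp add: \<mu>_def)
  have "\<phi> \<in> borel_measurable (completion (M \<Otimes>\<^sub>M \<mu>))"
    using \<phi> \<mu>.prob_space_axioms sets_\<mu> by (simp add: completion_measurable_on_def L_def)
  from completion_pair_infinity_slices[OF M.sigma_finite_measure_axioms assms(2) \<mu>.sigma_finite_measure_axioms this]
  obtain B where B: "B \<in> sets (M \<Otimes>\<^sub>M \<mu>)" "\<forall>p\<in>B. \<phi> p = \<infinity>"
    and slices: "AE y in \<mu>. {w\<in>space M. \<phi> (w, y) = \<infinity>} - {w. (w, y) \<in> B} \<in> null_sets M"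
    by blast
  have sets_pair: "sets (M \<Otimes>\<^sub>M \<mu>) = sets (M \<Otimes>\<^sub>M L)"
    by (rule sets_pair_measure_cong[OF refl sets_\<mu>])
  \<comment> \<open>Discarding the scenarios with non-finite \<open>g\<close> costs no mass and
    makes every remaining infinite value a genuine infeasibility.\<close>
  define B' where "B' = B - (Ng \<times> space L)"
  have B'[measurable]: "B' \<in> sets (M \<Otimes>\<^sub>M L)"
    unfolding B'_def using B(1) Ng(3) by (auto simp: sets_pair)
  have B'_infeas: "\<not> feas (\<xi> w) y" if "(w, y) \<in> B'" for w y
  proof (rule not_feas)
    have "(w, y) \<in> space (M \<Otimes>\<^sub>M L)" using that sets.sets_into_space[OF B'] by blast
    then have "w \<in> space M" "y \<in> space L" by (auto simp: space_pair_measure)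
    then show "w \<in> space M" "w \<notin> Ng" using that by (auto simp: B'_def)
    show "f (\<xi> w) y = \<infinity>" using that B(2) by (auto simp: B'_def \<phi>_def)
  qed
  have "AE y in \<mu>. ennreal (violation_prob M \<xi> f y) \<le> emeasure M {w\<in>space M. (w, y) \<in> B'}"
    using slices AE_space
  proof eventually_elim
    case (elim y)
    let ?F = "{w\<in>space M. f (\<xi> w) y = \<infinity>}" and ?B = "{w\<in>space M. (w, y) \<in> B'}"
    have y: "y \<in> space L" using elim(2) by (simp add: \<mu>_def)
    have Bs: "?B \<in> sets M" using y by measurable
    have "Ng \<in> null_sets M" using Ng by auto
    then have null: "({w\<in>space M. \<phi> (w, y) = \<infinity>} - {w. (w, y) \<in> B}) \<union> Ng \<in> null_sets M" (is "?N \<in> _")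
      using elim(1) by (intro null_sets.Un)
    have "?F \<subseteq> ?B \<union> ?N" by (auto simp: B'_def \<phi>_def)
    then have "emeasure M ?F \<le> emeasure M (?B \<union> ?N)"
      using Bs null by (intro emeasure_mono) auto
    also have "\<dots> = emeasure M ?B" by (rule emeasure_Un_null_set[OF Bs null])
    finally show ?case by (simp add: violation_prob_def M.emeasure_eq_measure)
  qed
  then have mass: "AE \<omega> in P. ennreal (violation_prob M \<xi> f (v \<omega>)) \<le> emeasure M {w\<in>space M. (w, v \<omega>) \<in> B'}"
    unfolding \<mu>_def by (rule AE_distrD[OF v])

  \<comment> \<open>Growth bound and convergence rate\<close>
  have rate: "measure (completion P) {\<omega>\<in>space (completion P). \<epsilon> < violation_prob M \<xi> f (u \<omega>)}
      \<le> 2 * exp (- (real N * \<epsilon> / 4)) * (12 / \<epsilon>) powr d" (is "measure _ ?S \<le> _")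
    if \<epsilon>: "0 < \<epsilon>" "\<epsilon> < 1" for \<epsilon>
  proof (cases "?S \<in> sets (completion P)")
    \<comment> \<open>\<open>measure\<close> is 0 by default on a non-measurable set.\<close>
    case False
    then have "measure (completion P) ?S = 0" by (rule measure_notin_sets)
    then show ?thesis by simp
  next
    case True
    \<comment> \<open>A set measurable for \<open>P\<close> itself with the same probability, on
      which the output is feasible and equal to \<open>v\<close> everywhere.\<close>
    define S where "S = main_part P ?S - N1"
    have main: "main_part P ?S \<in> sets P" "main_part P ?S \<subseteq> ?S"
      using main_part_null_part_Un[OF True] main_part_sets[OF True] by blast+
    have S[measurable]: "S \<in> sets P" unfolding S_def using main(1) N1(3) by blast
    have S_eq: "measure (completion P) ?S = measure P S"
    proof -
      have "emeasure P S = emeasure P (main_part P ?S)"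
        unfolding S_def using N1 main(1) by (intro emeasure_Diff_null_set) auto
      then show ?thesis using True by (simp add: measure_def emeasure_completion)
    qed
    have S_D: "u \<omega> \<in> saa_feasible X f N (iid_sample \<xi> N \<omega>)" "u \<omega> = v \<omega>" "\<epsilon> < violation_prob M \<xi> f (u \<omega>)"
      if "\<omega> \<in> S" for \<omega>
      using that N1(1) main sets.sets_into_space[OF S] unfolding S_def by blast+
    have growth: "measure P S * (1 + \<epsilon>) ^ N \<le> (1 + s) ^ (2 * N * (card Z * J)) / s ^ CARD('n)"
      if s: "0 < s" "s \<le> 1" for s
      unfolding P_def
    proof (rule M.double_sampling_bound[where A = "\<lambda>w y. \<not> feas (\<xi> w) y" and x = v and L = L and B = B'])
      show "S \<in> sets (\<Pi>\<^sub>M i\<in>{..<N}. M)" "v \<in> measurable (\<Pi>\<^sub>M i\<in>{..<N}. M) L"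
        using S v by (simp_all add: P_def)
      show "B' \<in> sets (M \<Otimes>\<^sub>M L)" by (rule B')
      show "0 \<le> \<epsilon>" using \<epsilon> by simp
      show "\<not> feas (\<xi> w) y" if "(w, y) \<in> B'" for w y using that by (rule B'_infeas)
      show "\<not> \<not> feas (\<xi> (\<omega> i)) (v \<omega>)" if "\<omega> \<in> S" "i < N" for \<omega> i
      proof
        assume "\<not> feas (\<xi> (\<omega> i)) (v \<omega>)"
        then have "f (\<xi> (\<omega> i)) (v \<omega>) = \<infinity>" by (rule infeas)
        then show False using S_D[OF that(1)] that(2) by (auto simp: saa_feasible_def iid_sample_def)
      qed
      show "AE \<omega> in \<Pi>\<^sub>M i\<in>{..<N}. M. \<omega> \<in> S \<longrightarrow> ennreal \<epsilon> \<le> emeasure M {w\<in>space M. (w, v \<omega>) \<in> B'}"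
        using mass unfolding P_def[symmetric]
      proof eventually_elim
        case (elim \<omega>)
        show ?case
        proof
          assume "\<omega> \<in> S"
          then have "ennreal \<epsilon> \<le> ennreal (violation_prob M \<xi> f (v \<omega>))"
            using S_D[of \<omega>] by (intro ennreal_leI) simp
          then show "ennreal \<epsilon> \<le> emeasure M {w\<in>space M. (w, v \<omega>) \<in> B'}" using elim by (rule order_trans)
        qed
      qed
      fix z assume "z \<in> {..<2 * N} \<rightarrow> space M"
      then have "\<xi> (z j) \<in> \<Xi>" if "j \<in> {..<2 * N}" for j using \<xi>_in that by blast
      from card_recourse_traces[where Q = "{..<2 * N}" and \<zeta> = "\<lambda>j. \<xi> (z j)",
          OF \<open>Z \<subseteq> carrier_vec p'\<close> \<open>finite Z\<close> assms(9-13) assms(21) cardJ _ this s]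
      show "real (card (range (\<lambda>y. {j\<in>{..<2 * N}. \<not> feas (\<xi> (z j)) y})))
          \<le> (1 + s) ^ (2 * N * (card Z * J)) / s ^ CARD('n)"
        by (simp add: feas_def)
    qed
    show ?thesis unfolding S_eq d_def
      by (rule rate_from_growth_bound[OF \<epsilon> _ growth]) simp_all
  qed
  show ?thesis unfolding sample
    using rate rate_imp_sample_complexity unfolding u_def by (meson order_trans)
qed

end
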